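(* Let $(\mathscr{A},\delta)$ be a discrete quantum group, let $$\mathscr{AP}=\{x\in M(\mathscr{A}):\ \delta(x)\in M(\mathscr{A})\otimes M(\mathscr{A})\},$$ and let $\chi:\mathscr{AP}\to M(\mathscr{A})$ be the inclusion. Let $(\mathscr{B},\delta_{\mathscr{B}})$ be a multiplier Hopf algebra of compact type (i.e. a Hopf algebra) and let $\Phi:\mathscr{B}\to M(\mathscr{A})$ be a non degenerate homomorphism such that $$(\Phi\otimes\Phi)\circ\delta_{\mathscr{B}}=\delta\circ\Phi.$$ Then there exists a unique Hopf algebra homomorphism $\overline{\Phi}:\mathscr{B}\to\mathscr{AP}$ such that $\Phi=\chi\circ\overline{\Phi}$.
   Context: All algebras are over $\mathbb{C}$; $\otimes$ is the algebraic tensor product. For an algebra $\mathscr{A}$ with non degenerate product, $M(\mathscr{A})$ is its multiplier algebra (pairs of linear maps $a\mapsto ma$, $a\mapsto am$ on $\mathscr{A}$ with $(bm)a=b(ma)$). A homomorphism $\Phi:\mathscr{B}\to M(\mathscr{A})$ is non degenerate if $\Phi(\mathscr{B})\mathscr{A}=\mathscr{A}\Phi(\mathscr{B})=\mathscr{A}$ (linear spans of products); it then extends uniquely to a unital homomorphism $M(\mathscr{B})\to M(\mathscr{A})$, denoted by the same symbol. A multiplier Hopf algebra is a pair $(\mathscr{A},\delta)$ of an algebra $\mathscr{A}$ with non degenerate product and a homomorphism $\delta:\mathscr{A}\to M(\mathscr{A}\otimes\mathscr{A})$ such that the maps $T_1(a\otimes b)=\delta(a)(I\otimes b)$ and $T_2(a\otimes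 b)=(a\otimes I)\delta(b)$ are bijections of $\mathscr{A}\otimes\mathscr{A}$ onto $\mathscr{A}\otimes\mathscr{A}$, and $T_2\otimes\mathrm{id}$ and $\mathrm{id}\otimes T_1$ commute on $\mathscr{A}\otimes\mathscr{A}\otimes\mathscr{A}$. Then $\delta$ is non degenerate. There is a multiplicative functional $\varepsilon$ on $\mathscr{A}$ (counit) with $(\mathrm{id}\otimes\varepsilon)((a\otimes I)\delta(b))=ab=(\varepsilon\otimes\mathrm{id})(\delta(a)(I\otimes b))$, and an antihomomorphism $\kappa:\mathscr{A}\to M(\mathscr{A})$ (coinverse, antipode) with $\mu[(\mathrm{id}\otimes\kappa)((a\otimes I)\delta(b))(I\otimes c)]=a\varepsilon(b)c$ and $\mu[(a\otimes I)(\kappa\otimes\mathrm{id})(\delta(b)(I\otimes c))]=a\varepsilon(b)c$ for all $a,b,c\in\mathscr{A}$, where $\mu$ is multiplication. It is a multiplier Hopf $*$-algebra if $\mathscr{A}$ is a $*$-algebra and $\delta$ is a $*$-homomorphism; in that case $\kappa$ is an antiisomorphism $\mathscr{A}\to\mathscr{A}$ and extends to an antiisomorphism $M(\mathscr{A})\to M(\mathscr{A})$. A discrete quantum group is a multiplier Hopf $*$-algebra $(\mathscr{A},\delta)$ such that $\mathscr{A}$ is a direct sum of full matrix algebras. A multiplier Hopf algebra of compact type is simply a (unital) Hopf algebra. In the claim, $\delta$ denotes the extension $M(\mathscr{A})\to M(\mathscr{A}\otimes\mathscr{A})$ of the comultiplication, and $M(\mathscr{A})\otimes M(\mathscr{A})$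 is regarded as a subalgebra of $M(\mathscr{A}\otimes\mathscr{A})$. The set $\mathscr{AP}$ is a unital $*$-subalgebra of $M(\mathscr{A})$ and is a Hopf ($*$-)algebra with the restrictions of the extensions to $M(\mathscr{A})$ of $\delta$, $\varepsilon$, $\kappa$ as comultiplication, counit and coinverse; this is the Hopf algebra structure on $\mathscr{AP}$ meant in the claim. *)

theory Defs
  imports Complex_Main "HOL-Library.Multiset" "HOL-Library.FuncSet" "Jordan_Normal_Form.Matrix"
begin

section \<open>Complex algebras\<close>

class complex_vector = ab_group_add +
  fixes scaleC :: "complex \<Rightarrow> 'a \<Rightarrow> 'a" (infixr \<open>*\<^sub>C\<close> 75)
  assumes scaleC_add_right: "c *\<^sub>C (x + y) = c *\<^sub>C x + c *\<^sub>C y"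
    and scaleC_add_left: "(c + d) *\<^sub>C x = c *\<^sub>C x + d *\<^sub>C x"
    and scaleC_scaleC: "c *\<^sub>C d *\<^sub>C x = (c * d) *\<^sub>C x"
    and scaleC_one: "1 *\<^sub>C x = x"

global_interpretation complex_vector: vector_space "scaleC :: complex \<Rightarrow> 'a \<Rightarrow> 'a::complex_vector"
  by unfold_locales (simp_all add: scaleC_add_right scaleC_add_left scaleC_scaleC scaleC_one)

abbreviation clinear :: "('a::complex_vector \<Rightarrow> 'b::complex_vector) \<Rightarrow> bool" where
  "clinear \<equiv> Vector_Spaces.linear scaleC scaleC"

class complex_algebra = complex_vector + ring +
  assumes scaleC_mult_left: "(c *\<^sub>C x) * y = c *\<^sub>C (x * y)"
    and scaleC_mult_right: "x * (c *\<^sub>C y) = c *\<^sub>C (x * y)"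

text \<open>A unital algebra may be zero, since the multiplier algebra of the zero algebra is.\<close>

class complex_unital_algebra = complex_algebra + monoid_mult

class complex_star_algebra = complex_algebra +
  fixes star :: "'a \<Rightarrow> 'a"
  assumes star_add: "star (x + y) = star x + star y"
    and star_scaleC: "star (c *\<^sub>C x) = cnj c *\<^sub>C star x"
    and star_mult: "star (x * y) = star y * star x"
    and star_star: "star (star x) = x"

instantiation complex :: complex_unital_algebra
begin
definition scaleC_complex :: "complex \<Rightarrow> complex \<Rightarrow> complex" where "scaleC_complex c x = c * x"
instance by standard (simp_all add: scaleC_complex_def algebra_simps)
end

definition alg_hom :: "('a::complex_algebra \<Rightarrow> 'b::complex_algebra) \<Rightarrow> bool" where
  "alg_hom f \<longleftrightarrow> clinear f \<and> (\<forall>a b. f (a * b) = f a * f b)"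

definition alg_antihom :: "('a::complex_algebra \<Rightarrow> 'b::complex_algebra) \<Rightarrow> bool" where
  "alg_antihom f \<longleftrightarrow> clinear f \<and> (\<forall>a b. f (a * b) = f b * f a)"

definition nondegenerate_product :: "'a::complex_algebra itself \<Rightarrow> bool" where
  "nondegenerate_product _ \<longleftrightarrow>
    (\<forall>a::'a. (\<forall>b. a * b = 0) \<longrightarrow> a = 0) \<and> (\<forall>a::'a. (\<forall>b. b * a = 0) \<longrightarrow> a = 0)"

lemma clinearI:
  assumes "\<And>x y. f (x + y) = f x + f y" and "\<And>c x. f (c *\<^sub>C x) = c *\<^sub>C f x"
  shows "clinear f"
  using assms by unfold_locales auto

lemma clinearD:
  assumes "clinear f"
  shows "f (x + y) = f x + f y" and "f (c *\<^sub>C x) = c *\<^sub>C f x" and "f 0 = 0"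
    and "f (- x) = - f x" and "f (x - y) = f x - f y"
proof -
  interpret Vector_Spaces.linear scaleC scaleC f by (fact assms)
  show "f (x + y) = f x + f y" "f (c *\<^sub>C x) = c *\<^sub>C f x" "f 0 = 0" "f (- x) = - f x" "f (x - y) = f x - f y"
    by (simp_all add: add scale zero neg diff)
qed

lemma star_zero [simp]: "star (0::'a::complex_star_algebra) = 0"
  using star_add[of "0::'a" 0] by simp


section \<open>The algebraic tensor product\<close>

text \<open>Formal sums of pairs are finite multisets; the scalars are absorbed in the pairs.\<close>

inductive tensor_eq :: "('a::complex_vector \<times> 'b::complex_vector) multiset \<Rightarrow> ('a \<times> 'b) multiset \<Rightarrow> bool" where
  tensor_eq_refl: "tensor_eq X X"
| tensor_eq_sym: "tensor_eq X Y \<Longrightarrow> tensor_eq Y X"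
| tensor_eq_trans: "tensor_eq X Y \<Longrightarrow> tensor_eq Y Z \<Longrightarrow> tensor_eq X Z"
| tensor_eq_plus: "tensor_eq X Y \<Longrightarrow> tensor_eq (X + Z) (Y + Z)"
| tensor_eq_zero: "tensor_eq {#(0, b)#} {#}"
| tensor_eq_add_left: "tensor_eq {#(a + a', b)#} {#(a, b), (a', b)#}"
| tensor_eq_add_right: "tensor_eq {#(a, b + b')#} {#(a, b), (a, b')#}"
| tensor_eq_scale: "tensor_eq {#(c *\<^sub>C a, b)#} {#(a, c *\<^sub>C b)#}"

quotient_type (overloaded) ('a, 'b) tensor = "('a::complex_vector \<times> 'b::complex_vector) multiset" / tensor_eq
  by (rule equivpI; unfold reflp_def symp_def transp_def)
    (blast intro: tensor_eq.intros)+

lift_definition pure_tensor :: "'a::complex_vector \<Rightarrow> 'b::complex_vector \<Rightarrow> ('a, 'b) tensor"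
  (infixr \<open>\<otimes>\<^sub>t\<close> 72) is "\<lambda>a b. {#(a, b)#}" .

lemma tensor_eq_plus2: "tensor_eq X Y \<Longrightarrow> tensor_eq X' Y' \<Longrightarrow> tensor_eq (X + X') (Y + Y')"
  by (metis add.commute tensor_eq_plus tensor_eq_trans)

lemma tensor_eq_map:
  assumes "tensor_eq X Y" and "\<And>a b. g (a + b) = g a + g b"
    and "\<And>c a. g (c *\<^sub>C a) = c *\<^sub>C g a"
  shows "tensor_eq (image_mset (\<lambda>(a, b). (g a, b)) X) (image_mset (\<lambda>(a, b). (g a, b)) Y)"
  using assms(1)
proof induction
  case (tensor_eq_zero b)
  have "g 0 = 0" using assms(2)[of 0 0] by simp
  then show ?case by (simp add: tensor_eq.tensor_eq_zero)
next
  case (tensor_eq_trans X Y Z)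
  then show ?case by (blast intro: tensor_eq.tensor_eq_trans)
next
  case (tensor_eq_sym X Y)
  then show ?case by (blast intro: tensor_eq.tensor_eq_sym)
qed (simp_all add: assms tensor_eq.tensor_eq_refl tensor_eq.tensor_eq_plus tensor_eq.tensor_eq_add_left
    tensor_eq.tensor_eq_add_right tensor_eq.tensor_eq_scale)

instantiation tensor :: (complex_vector, complex_vector) complex_vector
begin

lift_definition zero_tensor :: "('a, 'b) tensor" is "{#}" .

lift_definition plus_tensor :: "('a, 'b) tensor \<Rightarrow> ('a, 'b) tensor \<Rightarrow> ('a, 'b) tensor" is "(+)"
  by (rule tensor_eq_plus2)

lift_definition uminus_tensor :: "('a, 'b) tensor \<Rightarrow> ('a, 'b) tensor"
  is "image_mset (\<lambda>(a, b). (- a, b))"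
  by (rule tensor_eq_map) simp_all

definition minus_tensor :: "('a, 'b) tensor \<Rightarrow> ('a, 'b) tensor \<Rightarrow> ('a, 'b) tensor" where
  "minus_tensor x y = x + (- y)"

lift_definition scaleC_tensor :: "complex \<Rightarrow> ('a, 'b) tensor \<Rightarrow> ('a, 'b) tensor"
  is "\<lambda>c. image_mset (\<lambda>(a, b). (c *\<^sub>C a, b))"
  by (rule tensor_eq_map) (simp_all add: scaleC_add_right scaleC_scaleC mult.commute)

instance
proof
  fix x y z :: "('a, 'b) tensor" and c d :: complex
  show "x + y + z = x + (y + z)" by transfer (simp add: tensor_eq_refl ac_simps)
  show "x + y = y + x" by transfer (simp add: tensor_eq_refl ac_simps)
  show "0 + x = x" by transfer (simp add: tensor_eq_refl)
  show "- x + x = 0"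
  proof transfer
    fix X :: "('a \<times> 'b) multiset"
    show "tensor_eq (image_mset (\<lambda>(a, b). (- a, b)) X + X) {#}"
    proof (induction X)
      case empty
      then show ?case by (simp add: tensor_eq_refl)
    next
      case (add p X)
      obtain a b where p: "p = (a, b)" by fastforce
      have "tensor_eq {#(- a, b), (a, b)#} {#}"
        using tensor_eq_add_left[of "- a" a b] tensor_eq_zero[of b]
        by (metis add.left_inverse tensor_eq_sym tensor_eq_trans)
      from tensor_eq_plus2[OF this add] show ?case by (simp add: p add_mset_commute)
    qed
  qed
  show "x - y = x + - y" by (rule minus_tensor_def)
  show "c *\<^sub>C (x + y) = c *\<^sub>C x + c *\<^sub>C y" by transfer (simp add: tensor_eq_refl)
  show "(c + d) *\<^sub>C x = c *\<^sub>C x + d *\<^sub>C x"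
  proof transfer
    fix c d and X :: "('a \<times> 'b) multiset"
    show "tensor_eq (image_mset (\<lambda>(a, b). ((c + d) *\<^sub>C a, b)) X)
      (image_mset (\<lambda>(a, b). (c *\<^sub>C a, b)) X + image_mset (\<lambda>(a, b). (d *\<^sub>C a, b)) X)"
    proof (induction X)
      case empty
      then show ?case by (simp add: tensor_eq_refl)
    next
      case (add p X)
      obtain a b where p: "p = (a, b)" by fastforce
      from tensor_eq_plus2[OF tensor_eq_add_left[of "c *\<^sub>C a" "d *\<^sub>C a" b] add] show ?case
        by (simp add: p scaleC_add_left add_mset_commute)
    qed
  qed
  show "c *\<^sub>C d *\<^sub>C x = (c * d) *\<^sub>C x"
    by transfer (simp add: tensor_eq_refl image_mset.compositionality o_def case_prod_unfold scaleC_scaleC)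
  show "1 *\<^sub>C x = x"
    by transfer (simp add: tensor_eq_refl scaleC_one)
qed

end

lemma pure_tensor_add_left: "(a + a') \<otimes>\<^sub>t b = a \<otimes>\<^sub>t b + a' \<otimes>\<^sub>t b"
  by transfer (simp add: tensor_eq_add_left add_mset_commute)

lemma pure_tensor_add_right: "a \<otimes>\<^sub>t (b + b') = a \<otimes>\<^sub>t b + a \<otimes>\<^sub>t b'"
  by transfer (simp add: tensor_eq_add_right add_mset_commute)

lemma pure_tensor_scale_left: "(c *\<^sub>C a) \<otimes>\<^sub>t b = c *\<^sub>C (a \<otimes>\<^sub>t b)"
  by transfer (simp add: tensor_eq_refl)

lemma pure_tensor_scale_right: "a \<otimes>\<^sub>t (c *\<^sub>C b) = c *\<^sub>C (a \<otimes>\<^sub>t b)"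
  by transfer (auto intro: tensor_eq_scale tensor_eq_sym)

lemma pure_tensor_zero_left [simp]: "0 \<otimes>\<^sub>t b = 0"
  by transfer (rule tensor_eq_zero)

lemma pure_tensor_zero_right [simp]: "a \<otimes>\<^sub>t 0 = 0"
  using pure_tensor_add_right[of a 0 0] by simp

lemma tensor_induct [case_names zero pure add]:
  assumes "P 0" and "\<And>a b. P (a \<otimes>\<^sub>t b)" and "\<And>x y. P x \<Longrightarrow> P y \<Longrightarrow> P (x + y)"
  shows "P (t :: ('a::complex_vector, 'b::complex_vector) tensor)"
proof -
  have "P (abs_tensor X)" for X :: "('a \<times> 'b) multiset"
  proof (induction X)
    case empty
    then show ?case using assms(1) by (simp add: zero_tensor_def)
  next
    case (add p X)
    obtain a b where p: "p = (a, b)" by fastforce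
    have "abs_tensor (add_mset p X) = a \<otimes>\<^sub>t b + abs_tensor X"
      by (simp add: p pure_tensor.abs_eq plus_tensor.abs_eq)
    then show ?case using assms(2,3) add by simp
  qed
  from this[of "rep_tensor t"] show ?thesis by (simp add: Quotient_abs_rep[OF Quotient_tensor])
qed

text \<open>A balanced biadditive map, in particular a bilinear or a bi-antilinear one, factors through the
  tensor product; \<open>tensor_lift f\<close> is the induced map (meaningless if \<open>f\<close> is not balanced).\<close>

definition balanced :: "('a::complex_vector \<Rightarrow> 'b::complex_vector \<Rightarrow> 'c::ab_group_add) \<Rightarrow> bool" where
  "balanced f \<longleftrightarrow> (\<forall>a a' b. f (a + a') b = f a b + f a' b) \<and>
     (\<forall>a b b'. f a (b + b') = f a b + f a b') \<and> (\<forall>c a b. f (c *\<^sub>C a) b = f a (c *\<^sub>C b))"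

definition tensor_lift ::
  "('a::complex_vector \<Rightarrow> 'b::complex_vector \<Rightarrow> 'c::ab_group_add) \<Rightarrow> ('a, 'b) tensor \<Rightarrow> 'c" where
  "tensor_lift f t = (\<Sum>(a, b)\<in>#rep_tensor t. f a b)"

lemma balancedI:
  assumes "\<And>a a' b. f (a + a') b = f a b + f a' b" and "\<And>a b b'. f a (b + b') = f a b + f a b'"
    and "\<And>c a b. f (c *\<^sub>C a) b = f a (c *\<^sub>C b)"
  shows "balanced f"
  using assms by (simp add: balanced_def)

lemma balanced_zero: "balanced f \<Longrightarrow> f 0 b = 0"
  unfolding balanced_def by (metis add_cancel_right_right)

lemma tensor_lift_abs:
  assumes "balanced f"
  shows "tensor_lift f (abs_tensor X) = (\<Sum>(a, b)\<in>#X. f a b)"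
proof -
  have *: "(\<Sum>(a, b)\<in>#X. f a b) = (\<Sum>(a, b)\<in>#Y. f a b)" if "tensor_eq X Y" for X Y
    using that
    by induction (use assms in \<open>auto simp: balanced_zero[OF assms] balanced_def\<close>)
  have "tensor_eq (rep_tensor (abs_tensor X)) X"
    by (metis Quotient3_tensor rep_abs_rsp_left tensor_eq_refl)
  from *[OF this] show ?thesis by (simp add: tensor_lift_def)
qed

lemma tensor_lift_pure [simp]: "balanced f \<Longrightarrow> tensor_lift f (a \<otimes>\<^sub>t b) = f a b"
  by (simp add: tensor_lift_abs pure_tensor.abs_eq)

lemma tensor_lift_zero [simp]: "balanced f \<Longrightarrow> tensor_lift f 0 = 0"
  by (simp add: tensor_lift_abs zero_tensor_def)

lemma tensor_lift_add [simp]: "balanced f \<Longrightarrow> tensor_lift f (x + y) = tensor_lift f x + tensor_lift f y"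
proof -
  assume f: "balanced f"
  obtain X Y where x: "x = abs_tensor X" and y: "y = abs_tensor Y"
    using Quotient_abs_rep[OF Quotient_tensor] by metis
  show ?thesis by (simp add: x y plus_tensor.abs_eq tensor_lift_abs[OF f])
qed

lemma tensor_lift_scaleC:
  fixes f :: "'a::complex_vector \<Rightarrow> 'b::complex_vector \<Rightarrow> 'c::complex_vector"
  assumes "balanced f" and "\<And>c a b. f (c *\<^sub>C a) b = \<sigma> c *\<^sub>C f a b"
  shows "tensor_lift f (c *\<^sub>C x) = \<sigma> c *\<^sub>C tensor_lift f x"
proof (induction x rule: tensor_induct)
  case (pure a b)
  then show ?case using assms
    by (simp flip: pure_tensor_scale_left)
qed (simp_all add: assms(1) scaleC_add_right)

definition tensor_map :: "('a::complex_vector \<Rightarrow> 'c::complex_vector) \<Rightarrow> ('b::complex_vector \<Rightarrow> 'd::complex_vector)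
    \<Rightarrow> ('a, 'b) tensor \<Rightarrow> ('c, 'd) tensor" where
  "tensor_map f g = tensor_lift (\<lambda>a b. f a \<otimes>\<^sub>t g b)"

lemma balanced_tensor_map:
  assumes "clinear f" and "clinear g"
  shows "balanced (\<lambda>a b. f a \<otimes>\<^sub>t g b)"
  by (rule balancedI)
    (simp_all add: clinearD[OF assms(1)] clinearD[OF assms(2)] pure_tensor_add_left
      pure_tensor_add_right pure_tensor_scale_left pure_tensor_scale_right)

lemma tensor_map_pure [simp]:
  "clinear f \<Longrightarrow> clinear g \<Longrightarrow> tensor_map f g (a \<otimes>\<^sub>t b) = f a \<otimes>\<^sub>t g b"
  by (simp add: tensor_map_def balanced_tensor_map)

lemma tensor_map_add:
  "clinear f \<Longrightarrow> clinear g \<Longrightarrow> tensor_map f g (x + y) = tensor_map f g x + tensor_map f g y"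
  by (simp add: tensor_map_def balanced_tensor_map)

lemma clinear_tensor_map:
  assumes "clinear f" and "clinear g"
  shows "clinear (tensor_map f g)"
proof (rule clinearI)
  show "tensor_map f g (c *\<^sub>C x) = c *\<^sub>C tensor_map f g x" for c x
    unfolding tensor_map_def
    by (rule tensor_lift_scaleC[where \<sigma> = "\<lambda>c. c", OF balanced_tensor_map[OF assms]])
      (simp add: clinearD[OF assms(1)] pure_tensor_scale_left)
qed (simp add: tensor_map_add assms)

definition tensor_assoc :: "(('a::complex_vector, 'b::complex_vector) tensor, 'c::complex_vector) tensor
    \<Rightarrow> ('a, ('b, 'c) tensor) tensor" where
  "tensor_assoc = tensor_lift (\<lambda>t c. tensor_lift (\<lambda>a b. a \<otimes>\<^sub>t (b \<otimes>\<^sub>t c)) t)"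

lemma tensor_assoc_pure: "tensor_assoc ((a \<otimes>\<^sub>t b) \<otimes>\<^sub>t c) = a \<otimes>\<^sub>t (b \<otimes>\<^sub>t c)"
proof -
  define h :: "'c \<Rightarrow> ('a, 'b) tensor \<Rightarrow> ('a, ('b, 'c) tensor) tensor"
    where "h c = tensor_lift (\<lambda>a b. a \<otimes>\<^sub>t (b \<otimes>\<^sub>t c))" for c
  have bal: "balanced (\<lambda>(a::'a) (b::'b). a \<otimes>\<^sub>t (b \<otimes>\<^sub>t (c::'c)))" for c
    by (rule balancedI) (simp_all add: pure_tensor_add_left pure_tensor_add_right
        pure_tensor_scale_left pure_tensor_scale_right)
  have h: "h c 0 = 0" "h c (a \<otimes>\<^sub>t b) = a \<otimes>\<^sub>t (b \<otimes>\<^sub>t c)" "h c (x + y) = h c x + h c y" for a b c x y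
    by (simp_all add: h_def bal)
  have "balanced (\<lambda>t c. h c t)"
  proof (rule balancedI)
    fix t :: "('a, 'b) tensor" and x y :: 'c and c :: complex
    show "h (x + y) t = h x t + h y t"
      by (induction t rule: tensor_induct) (simp_all add: h pure_tensor_add_right ac_simps)
    have "h x (c *\<^sub>C t) = c *\<^sub>C h x t"
      unfolding h_def
      by (rule tensor_lift_scaleC[where \<sigma> = "\<lambda>c. c", OF bal]) (rule pure_tensor_scale_left)
    also have "\<dots> = h (c *\<^sub>C x) t"
      by (induction t rule: tensor_induct) (simp_all add: h scaleC_add_right pure_tensor_scale_right)
    finally show "h x (c *\<^sub>C t) = h (c *\<^sub>C x) t" .
  qed (rule h)
  from tensor_lift_pure[OF this] show ?thesis
    by (simp add: tensor_assoc_def h flip: h_def)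
qed

definition tensor_subspace :: "'a::complex_vector set \<Rightarrow> 'b::complex_vector set \<Rightarrow> ('a, 'b) tensor set" where
  "tensor_subspace S T = complex_vector.span {a \<otimes>\<^sub>t b |a b. a \<in> S \<and> b \<in> T}"

lemma balanced_mult_aux:
  fixes a :: "'a::complex_algebra" and b :: "'b::complex_algebra"
  shows "balanced (\<lambda>c d. (a * c) \<otimes>\<^sub>t (b * d))"
  by (rule balancedI) (simp_all add: distrib_left pure_tensor_add_left pure_tensor_add_right
      pure_tensor_scale_left pure_tensor_scale_right scaleC_mult_right)

lemma balanced_mult:
  fixes s :: "('a::complex_algebra, 'b::complex_algebra) tensor"
  shows "balanced (\<lambda>a b. tensor_lift (\<lambda>c d. (a * c) \<otimes>\<^sub>t (b * d)) s)"
proof -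
  define h :: "'a \<Rightarrow> 'b \<Rightarrow> ('a, 'b) tensor \<Rightarrow> ('a, 'b) tensor"
    where "h a b = tensor_lift (\<lambda>c d. (a * c) \<otimes>\<^sub>t (b * d))" for a b
  have h: "h a b 0 = 0" "h a b (c \<otimes>\<^sub>t d) = (a * c) \<otimes>\<^sub>t (b * d)" "h a b (x + y) = h a b x + h a b y"
    for a b c d x y
    by (simp_all add: h_def balanced_mult_aux)
  have "balanced (\<lambda>a b. h a b s)"
  proof (rule balancedI)
    fix a a' :: 'a and b b' :: 'b and c :: complex
    show "h (a + a') b s = h a b s + h a' b s"
      by (induction s rule: tensor_induct) (simp_all add: h distrib_right pure_tensor_add_left ac_simps)
    show "h a (b + b') s = h a b s + h a b' s"
      by (induction s rule: tensor_induct) (simp_all add: h distrib_right pure_tensor_add_right ac_simps)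
    show "h (c *\<^sub>C a) b s = h a (c *\<^sub>C b) s"
      by (induction s rule: tensor_induct)
        (simp_all add: h scaleC_mult_left pure_tensor_scale_left pure_tensor_scale_right)
  qed
  then show ?thesis by (simp add: h_def)
qed

instantiation tensor :: (complex_algebra, complex_algebra) complex_algebra
begin

definition times_tensor :: "('a, 'b) tensor \<Rightarrow> ('a, 'b) tensor \<Rightarrow> ('a, 'b) tensor" where
  "times_tensor t s = tensor_lift (\<lambda>a b. tensor_lift (\<lambda>c d. (a * c) \<otimes>\<^sub>t (b * d)) s) t"

lemma times_tensor_pure_left:
  "(a \<otimes>\<^sub>t b) * s = tensor_lift (\<lambda>c d. (a * c) \<otimes>\<^sub>t (b * d)) (s :: ('a, 'b) tensor)"
  unfolding times_tensor_def by (rule tensor_lift_pure[OF balanced_mult])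

lemma times_tensor_pure: "(a \<otimes>\<^sub>t b) * (c \<otimes>\<^sub>t d) = ((a * c) \<otimes>\<^sub>t (b * d) :: ('a, 'b) tensor)"
  by (simp add: times_tensor_pure_left balanced_mult_aux)

lemma times_tensor_add_left: "(x + y) * z = x * z + y * (z :: ('a, 'b) tensor)"
  unfolding times_tensor_def by (rule tensor_lift_add[OF balanced_mult])

lemma times_tensor_zero_left: "0 * z = (0 :: ('a, 'b) tensor)"
  unfolding times_tensor_def by (rule tensor_lift_zero[OF balanced_mult])

lemma times_tensor_zero_right: "z * 0 = (0 :: ('a, 'b) tensor)"
  by (induction z rule: tensor_induct)
    (simp_all add: times_tensor_zero_left times_tensor_add_left times_tensor_pure_left balanced_mult_aux)

lemma times_tensor_add_right: "z * (x + y) = z * x + z * (y :: ('a, 'b) tensor)"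
  by (induction z rule: tensor_induct)
    (simp_all add: times_tensor_zero_left times_tensor_add_left times_tensor_pure_left balanced_mult_aux ac_simps)

lemmas times_tensor_rules = times_tensor_pure times_tensor_add_left times_tensor_zero_left
  times_tensor_zero_right times_tensor_add_right

instance
proof
  fix x y z :: "('a, 'b) tensor" and c :: complex
  show "(x + y) * z = x * z + y * z" by (rule times_tensor_add_left)
  show "x * (y + z) = x * y + x * z" by (rule times_tensor_add_right)
  show "x * y * z = x * (y * z)"
  proof (induction x rule: tensor_induct)
    case (pure a b)
    show ?case
    proof (induction y rule: tensor_induct)
      case (pure a' b')
      show ?case by (induction z rule: tensor_induct) (simp_all add: times_tensor_rules mult.assoc)
    qed (simp_all add: times_tensor_rules)
  qed (simp_all add: times_tensor_rules)
  show "c *\<^sub>C x * y = c *\<^sub>C (x * y)"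
  proof (induction x rule: tensor_induct)
    case (pure a b)
    show ?case
      by (induction y rule: tensor_induct)
        (simp_all add: times_tensor_rules scaleC_add_right scaleC_mult_left flip: pure_tensor_scale_left)
  qed (simp_all add: times_tensor_rules scaleC_add_right)
  show "x * c *\<^sub>C y = c *\<^sub>C (x * y)"
  proof (induction x rule: tensor_induct)
    case (pure a b)
    show ?case
      by (induction y rule: tensor_induct)
        (simp_all add: times_tensor_rules scaleC_add_right scaleC_mult_right flip: pure_tensor_scale_left)
  qed (simp_all add: times_tensor_rules scaleC_add_right)
qed

end

instantiation tensor :: (complex_unital_algebra, complex_unital_algebra) complex_unital_algebra
begin

definition one_tensor :: "('a, 'b) tensor" where "one_tensor = 1 \<otimes>\<^sub>t 1"

instance
proof
  fix x :: "('a, 'b) tensor"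
  show "1 * x = x"
    by (induction x rule: tensor_induct) (simp_all add: times_tensor_pure distrib_left one_tensor_def)
  show "x * 1 = x"
    by (induction x rule: tensor_induct) (simp_all add: times_tensor_pure distrib_right one_tensor_def)
qed

end

lemma balanced_star:
  "balanced (\<lambda>(a::'a::complex_star_algebra) (b::'b::complex_star_algebra). star a \<otimes>\<^sub>t star b)"
  by (rule balancedI) (simp_all add: star_add star_scaleC pure_tensor_add_left pure_tensor_add_right
      pure_tensor_scale_left pure_tensor_scale_right)

instantiation tensor :: (complex_star_algebra, complex_star_algebra) complex_star_algebra
begin

definition star_tensor :: "('a, 'b) tensor \<Rightarrow> ('a, 'b) tensor" where
  "star_tensor = tensor_lift (\<lambda>a b. star a \<otimes>\<^sub>t star b)"

instance
proof
  fix x y :: "('a, 'b) tensor" and c :: complex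
  note [simp] = balanced_star
  show add: "star (x + y) = star x + star y" for x y :: "('a, 'b) tensor"
    by (simp add: star_tensor_def)
  have zero: "star (0 :: ('a, 'b) tensor) = 0" by (simp add: star_tensor_def)
  have star_pure: "star (a \<otimes>\<^sub>t b) = star a \<otimes>\<^sub>t star b" for a :: 'a and b :: 'b
    by (simp add: star_tensor_def)
  show "star (c *\<^sub>C x) = cnj c *\<^sub>C star x"
    unfolding star_tensor_def
    by (rule tensor_lift_scaleC) (simp_all add: star_scaleC pure_tensor_scale_left)
  show "star (x * y) = star y * star x"
  proof (induction x rule: tensor_induct)
    case (pure a b)
    show ?case
      by (induction y rule: tensor_induct)
        (simp_all add: add zero star_pure times_tensor_pure distrib_left distrib_right star_mult)
  qed (simp_all add: add zero distrib_left distrib_right)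
  show "star (star x) = x"
    by (induction x rule: tensor_induct) (simp_all add: add zero star_pure star_star)
qed

end


section \<open>Multiplier algebras\<close>

text \<open>A multiplier \<open>m\<close> is the pair of the maps \<open>a \<mapsto> m a\<close> and \<open>a \<mapsto> a m\<close>.\<close>

typedef (overloaded) 'a multiplier =
  "{(L, R). clinear L \<and> clinear R \<and> (\<forall>a b::'a::complex_algebra. R b * a = b * L a)}"
proof -
  have "clinear (\<lambda>x::'a. x)" by (rule clinearI) simp_all
  then show ?thesis by (intro exI[of _ "(\<lambda>x. x, \<lambda>x. x)"]) simp
qed

definition mleft :: "'a::complex_algebra multiplier \<Rightarrow> 'a \<Rightarrow> 'a" where
  "mleft m = fst (Rep_multiplier m)"

definition mright :: "'a::complex_algebra \<Rightarrow> 'a multiplier \<Rightarrow> 'a" where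
  "mright a m = snd (Rep_multiplier m) a"

definition mk_multiplier :: "('a::complex_algebra \<Rightarrow> 'a) \<Rightarrow> ('a \<Rightarrow> 'a) \<Rightarrow> 'a multiplier" where
  "mk_multiplier L R = Abs_multiplier (L, R)"

lemma clinear_mleft: "clinear (mleft m)" and clinear_mright: "clinear (\<lambda>a. mright a m)"
  and mright_mult: "mright b m * a = b * mleft m a"
  using Rep_multiplier[of m] by (auto simp: mleft_def mright_def case_prod_unfold)

lemma mk_multiplier:
  assumes "clinear L" and "clinear R" and "\<And>a b. R b * a = b * L a"
  shows "mleft (mk_multiplier L R) a = L a" and "mright a (mk_multiplier L R) = R a"
  using assms by (simp_all add: mleft_def mright_def mk_multiplier_def Abs_multiplier_inverse)

lemma multiplier_eqI:
  assumes "\<And>a. mleft m a = mleft n a" and "\<And>a. mright a m = mright a n"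
  shows "m = n"
proof -
  have "fst (Rep_multiplier m) = fst (Rep_multiplier n)" "snd (Rep_multiplier m) = snd (Rep_multiplier n)"
    using assms by (auto simp: mleft_def mright_def)
  then show ?thesis by (metis Rep_multiplier_inject prod_eqI)
qed

lemmas mleft_linear [simp] = clinearD[OF clinear_mleft]
lemmas mright_linear [simp] = clinearD[OF clinear_mright]

instantiation multiplier :: (complex_algebra) complex_algebra
begin

definition "0 = (mk_multiplier (\<lambda>_. 0) (\<lambda>_. 0) :: 'a multiplier)"
definition "m + n = (mk_multiplier (\<lambda>a. mleft m a + mleft n a) (\<lambda>a. mright a m + mright a n) :: 'a multiplier)"
definition "- m = (mk_multiplier (\<lambda>a. - mleft m a) (\<lambda>a. - mright a m) :: 'a multiplier)"
definition "m - n = (mk_multiplier (\<lambda>a. mleft m a - mleft n a) (\<lambda>a. mright a m - mright a n) :: 'a multiplier)"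
definition "c *\<^sub>C m = (mk_multiplier (\<lambda>a. c *\<^sub>C mleft m a) (\<lambda>a. c *\<^sub>C mright a m) :: 'a multiplier)"
definition "m * n = (mk_multiplier (\<lambda>a. mleft m (mleft n a)) (\<lambda>a. mright (mright a m) n) :: 'a multiplier)"

lemma multiplier_simps [simp]:
  fixes m n :: "'a multiplier"
  shows "mleft (0 :: 'a multiplier) a = 0" and "mright a (0 :: 'a multiplier) = 0"
    and "mleft (m + n) a = mleft m a + mleft n a" and "mright a (m + n) = mright a m + mright a n"
    and "mleft (- m) a = - mleft m a" and "mright a (- m) = - mright a m"
    and "mleft (m - n) a = mleft m a - mleft n a" and "mright a (m - n) = mright a m - mright a n"
    and "mleft (c *\<^sub>C m) a = c *\<^sub>C mleft m a" and "mright a (c *\<^sub>C m) = c *\<^sub>C mright a m"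
    and "mleft (m * n) a = mleft m (mleft n a)" and "mright a (m * n) = mright (mright a m) n"
  unfolding zero_multiplier_def plus_multiplier_def uminus_multiplier_def minus_multiplier_def
    scaleC_multiplier_def times_multiplier_def
  by (subst mk_multiplier; auto intro!: clinearI simp: algebra_simps scaleC_add_right
      scaleC_scaleC mright_mult scaleC_mult_left scaleC_mult_right)+

instance
  by standard (auto intro!: multiplier_eqI simp: algebra_simps scaleC_add_right scaleC_add_left
      scaleC_scaleC scaleC_one)

end

instantiation multiplier :: (complex_algebra) complex_unital_algebra
begin

definition "1 = (mk_multiplier (\<lambda>a. a) (\<lambda>a. a) :: 'a multiplier)"

lemma multiplier_one_simps [simp]:
  "mleft (1 :: 'a multiplier) a = a" "mright a (1 :: 'a multiplier) = a"
  unfolding one_multiplier_def by (subst mk_multiplier; auto intro!: clinearI)+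

instance by standard (auto intro!: multiplier_eqI)

end

instantiation multiplier :: (complex_star_algebra) complex_star_algebra
begin

definition "star m = (mk_multiplier (\<lambda>a. star (mright (star a) m)) (\<lambda>a. star (mleft m (star a))) :: 'a multiplier)"

lemma star_multiplier_simps [simp]:
  "mleft (star (m :: 'a multiplier)) a = star (mright (star a) m)"
  "mright a (star (m :: 'a multiplier)) = star (mleft m (star a))"
proof -
  have *: "star (mleft m (star b)) * a = b * star (mright (star a) m)" for a b
  proof -
    have "star (mleft m (star b)) * a = star (star a * mleft m (star b))"
      by (simp add: star_mult star_star)
    also have "\<dots> = star (mright (star a) m * star b)"
      by (simp add: mright_mult)
    finally show ?thesis by (simp add: star_mult star_star)
  qed
  show "mleft (star m) a = star (mright (star a) m)" "mright a (star m) = star (mleft m (star a))"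
    unfolding star_multiplier_def
    by (subst mk_multiplier; auto intro!: clinearI simp: star_add star_scaleC *)+
qed

instance
  by standard (auto intro!: multiplier_eqI simp: star_add star_scaleC star_star)

end

definition embed :: "'a::complex_algebra \<Rightarrow> 'a multiplier" where
  "embed a = mk_multiplier (\<lambda>x. a * x) (\<lambda>x. x * a)"

lemma embed_simps [simp]: "mleft (embed a) x = a * x" "mright x (embed a) = x * a"
  unfolding embed_def
  by (subst mk_multiplier; auto intro!: clinearI simp: algebra_simps scaleC_mult_left scaleC_mult_right)+

definition multiplier_tensor_pure :: "'a::complex_algebra multiplier \<Rightarrow> 'b::complex_algebra multiplier
    \<Rightarrow> ('a, 'b) tensor multiplier" where
  "multiplier_tensor_pure m n = mk_multiplier (tensor_map (mleft m) (mleft n))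
     (tensor_map (\<lambda>a. mright a m) (\<lambda>b. mright b n))"

lemma multiplier_tensor_pure_simps:
  "mleft (multiplier_tensor_pure m n) t = tensor_map (mleft m) (mleft n) t"
  "mright t (multiplier_tensor_pure m n) = tensor_map (\<lambda>a. mright a m) (\<lambda>b. mright b n) t"
proof -
  note lin = clinear_mleft clinear_mright
  have "tensor_map (\<lambda>a. mright a m) (\<lambda>b. mright b n) y * x = y * tensor_map (mleft m) (mleft n) x" for x y
  proof (induction y rule: tensor_induct)
    case (pure a b)
    show ?case
      by (induction x rule: tensor_induct)
        (simp_all add: lin tensor_map_add times_tensor_pure distrib_left mright_mult
          clinearD(3)[OF clinear_tensor_map])
  qed (simp_all add: lin tensor_map_add distrib_right clinearD(3)[OF clinear_tensor_map])
  then show "mleft (multiplier_tensor_pure m n) t = tensor_map (mleft m) (mleft n) t"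
    "mright t (multiplier_tensor_pure m n) = tensor_map (\<lambda>a. mright a m) (\<lambda>b. mright b n) t"
    unfolding multiplier_tensor_pure_def
    by (subst mk_multiplier; auto intro!: clinear_tensor_map lin)+
qed

text \<open>The canonical map \<open>M(A) \<otimes> M(B) \<rightarrow> M(A \<otimes> B)\<close>; it is injective if the products are
  non degenerate, and its range is \<open>M(A) \<otimes> M(B)\<close> regarded as a subalgebra of \<open>M(A \<otimes> B)\<close>.\<close>

definition multiplier_tensor :: "('a::complex_algebra multiplier, 'b::complex_algebra multiplier) tensor
    \<Rightarrow> ('a, 'b) tensor multiplier" where
  "multiplier_tensor = tensor_lift multiplier_tensor_pure"

lemma multiplier_tensor_simps:
  "mleft (multiplier_tensor (m \<otimes>\<^sub>t n)) (a \<otimes>\<^sub>t b) = mleft m a \<otimes>\<^sub>t mleft n b"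
  "mright (a \<otimes>\<^sub>t b) (multiplier_tensor (m \<otimes>\<^sub>t n)) = mright a m \<otimes>\<^sub>t mright b n"
proof -
  have pure: "mleft (multiplier_tensor_pure m n) (a \<otimes>\<^sub>t b) = mleft m a \<otimes>\<^sub>t mleft n b"
    "mright (a \<otimes>\<^sub>t b) (multiplier_tensor_pure m n) = mright a m \<otimes>\<^sub>t mright b n"
    for m :: "'a multiplier" and n :: "'b multiplier" and a b
    by (simp_all add: multiplier_tensor_pure_simps clinear_mleft clinear_mright)
  note rules = pure pure_tensor_add_left pure_tensor_add_right pure_tensor_scale_left pure_tensor_scale_right ac_simps
  have "balanced (multiplier_tensor_pure :: 'a multiplier \<Rightarrow> 'b multiplier \<Rightarrow> _)"
  proof (intro balancedI multiplier_eqI)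
    fix m m' :: "'a multiplier" and n n' :: "'b multiplier" and c and t :: "('a, 'b) tensor"
    show "mleft (multiplier_tensor_pure (m + m') n) t = mleft (multiplier_tensor_pure m n + multiplier_tensor_pure m' n) t"
      by (induction t rule: tensor_induct) (simp_all add: rules)
    show "mright t (multiplier_tensor_pure (m + m') n) = mright t (multiplier_tensor_pure m n + multiplier_tensor_pure m' n)"
      by (induction t rule: tensor_induct) (simp_all add: rules)
    show "mleft (multiplier_tensor_pure m (n + n')) t = mleft (multiplier_tensor_pure m n + multiplier_tensor_pure m n') t"
      by (induction t rule: tensor_induct) (simp_all add: rules)
    show "mright t (multiplier_tensor_pure m (n + n')) = mright t (multiplier_tensor_pure m n + multiplier_tensor_pure m n')"
      by (induction t rule: tensor_induct) (simp_all add: rules)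
    show "mleft (multiplier_tensor_pure (c *\<^sub>C m) n) t = mleft (multiplier_tensor_pure m (c *\<^sub>C n)) t"
      by (induction t rule: tensor_induct) (simp_all add: rules)
    show "mright t (multiplier_tensor_pure (c *\<^sub>C m) n) = mright t (multiplier_tensor_pure m (c *\<^sub>C n))"
      by (induction t rule: tensor_induct) (simp_all add: rules)
  qed
  then show "mleft (multiplier_tensor (m \<otimes>\<^sub>t n)) (a \<otimes>\<^sub>t b) = mleft m a \<otimes>\<^sub>t mleft n b"
    "mright (a \<otimes>\<^sub>t b) (multiplier_tensor (m \<otimes>\<^sub>t n)) = mright a m \<otimes>\<^sub>t mright b n"
    by (simp_all add: multiplier_tensor_def pure)
qed

definition nondegenerate_hom :: "('b::complex_algebra \<Rightarrow> 'a::complex_algebra multiplier) \<Rightarrow> bool" where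
  "nondegenerate_hom \<Phi> \<longleftrightarrow> alg_hom \<Phi> \<and>
     complex_vector.span {mleft (\<Phi> b) a |b a. True} = UNIV \<and>
     complex_vector.span {mright a (\<Phi> b) |b a. True} = UNIV"

text \<open>The unital (anti)homomorphism on \<open>M(B)\<close> that extends a map on \<open>B\<close>. Besides multiplier
  algebras, the codomain can be \<open>\<complex> = M(\<complex>)\<close>, which is the case of a counit.\<close>

definition extend_hom :: "('b::complex_algebra \<Rightarrow> 'c::complex_unital_algebra) \<Rightarrow> 'b multiplier \<Rightarrow> 'c" where
  "extend_hom f = (THE F. alg_hom F \<and> F 1 = 1 \<and> (\<forall>b. F (embed b) = f b))"

definition extend_antihom :: "('b::complex_algebra \<Rightarrow> 'c::complex_unital_algebra) \<Rightarrow> 'b multiplier \<Rightarrow> 'c" where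
  "extend_antihom f = (THE F. alg_antihom F \<and> F 1 = 1 \<and> (\<forall>b. F (embed b) = f b))"


section \<open>Multiplier Hopf algebras and discrete quantum groups\<close>

definition mult_map :: "('a::complex_algebra, 'a) tensor \<Rightarrow> 'a" where
  "mult_map = tensor_lift (*)"

definition slice_right :: "('b::complex_vector \<Rightarrow> complex) \<Rightarrow> ('a::complex_vector, 'b) tensor \<Rightarrow> 'a" where
  "slice_right f = tensor_lift (\<lambda>a b. f b *\<^sub>C a)"

definition slice_left :: "('a::complex_vector \<Rightarrow> complex) \<Rightarrow> ('a, 'b::complex_vector) tensor \<Rightarrow> 'b" where
  "slice_left f = tensor_lift (\<lambda>a b. f a *\<^sub>C b)"

text \<open>\<open>\<delta>(a)(I \<otimes> b)\<close> and \<open>(a \<otimes> I)\<delta>(b)\<close> as elements of \<open>M(A \<otimes> A)\<close>. In a multiplier Hopf algebra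
  they lie in \<open>A \<otimes> A\<close>, and \<open>T1\<close>, \<open>T2\<close> are the resulting linear maps on \<open>A \<otimes> A\<close>.\<close>

definition T1_mult :: "('a::complex_algebra \<Rightarrow> ('a, 'a) tensor multiplier) \<Rightarrow> 'a \<Rightarrow> 'a \<Rightarrow> ('a, 'a) tensor multiplier" where
  "T1_mult \<delta> a b = \<delta> a * multiplier_tensor (1 \<otimes>\<^sub>t embed b)"

definition T2_mult :: "('a::complex_algebra \<Rightarrow> ('a, 'a) tensor multiplier) \<Rightarrow> 'a \<Rightarrow> 'a \<Rightarrow> ('a, 'a) tensor multiplier" where
  "T2_mult \<delta> a b = multiplier_tensor (embed a \<otimes>\<^sub>t 1) * \<delta> b"

definition T1 :: "('a::complex_algebra \<Rightarrow> ('a, 'a) tensor multiplier) \<Rightarrow> ('a, 'a) tensor \<Rightarrow> ('a, 'a) tensor" where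
  "T1 \<delta> = tensor_lift (\<lambda>a b. the_inv embed (T1_mult \<delta> a b))"

definition T2 :: "('a::complex_algebra \<Rightarrow> ('a, 'a) tensor multiplier) \<Rightarrow> ('a, 'a) tensor \<Rightarrow> ('a, 'a) tensor" where
  "T2 \<delta> = tensor_lift (\<lambda>a b. the_inv embed (T2_mult \<delta> a b))"

text \<open>The last clause states that \<open>T\<^sub>2 \<otimes> id\<close> and \<open>id \<otimes> T\<^sub>1\<close> commute on \<open>A \<otimes> A \<otimes> A\<close>, evaluated at an
  element \<open>x\<close> of \<open>(A \<otimes> A) \<otimes> A\<close>; \<open>y\<close> is \<open>(id \<otimes> T\<^sub>1)(x)\<close> with the brackets moved back.\<close>

definition multiplier_hopf_algebra :: "('a::complex_algebra \<Rightarrow> ('a, 'a) tensor multiplier) \<Rightarrow> bool" where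
  "multiplier_hopf_algebra \<delta> \<longleftrightarrow>
     nondegenerate_product TYPE('a) \<and> alg_hom \<delta> \<and>
     (\<forall>a b. T1_mult \<delta> a b \<in> range embed) \<and> (\<forall>a b. T2_mult \<delta> a b \<in> range embed) \<and>
     bij (T1 \<delta>) \<and> bij (T2 \<delta>) \<and>
     (\<forall>x y. tensor_assoc y = tensor_map id (T1 \<delta>) (tensor_assoc x) \<longrightarrow>
        tensor_map id (T1 \<delta>) (tensor_assoc (tensor_map (T2 \<delta>) id x))
          = tensor_assoc (tensor_map (T2 \<delta>) id y))"

definition multiplier_hopf_star_algebra :: "('a::complex_star_algebra \<Rightarrow> ('a, 'a) tensor multiplier) \<Rightarrow> bool" where
  "multiplier_hopf_star_algebra \<delta> \<longleftrightarrow>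
     multiplier_hopf_algebra \<delta> \<and> (\<forall>a. \<delta> (star a) = star (\<delta> a))"

definition counit :: "('a::complex_algebra \<Rightarrow> ('a, 'a) tensor multiplier) \<Rightarrow> 'a \<Rightarrow> complex" where
  "counit \<delta> = (THE \<epsilon>. alg_hom \<epsilon> \<and>
     (\<forall>a b. slice_right \<epsilon> (T2 \<delta> (a \<otimes>\<^sub>t b)) = a * b) \<and>
     (\<forall>a b. slice_left \<epsilon> (T1 \<delta> (a \<otimes>\<^sub>t b)) = a * b))"

text \<open>For \<open>t \<in> A \<otimes> A\<close>, \<open>(id \<otimes> \<kappa>)(t)(I \<otimes> c)\<close> lies in \<open>A \<otimes> A\<close> and is \<open>(id \<otimes> \<kappa>(-)c)(t)\<close>;
  similarly on the other side.\<close>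

definition coinverse :: "('a::complex_algebra \<Rightarrow> ('a, 'a) tensor multiplier) \<Rightarrow> 'a \<Rightarrow> 'a multiplier" where
  "coinverse \<delta> = (THE \<kappa>. alg_antihom \<kappa> \<and>
     (\<forall>a b c. mult_map (tensor_map id (\<lambda>q. mleft (\<kappa> q) c) (T2 \<delta> (a \<otimes>\<^sub>t b)))
        = counit \<delta> b *\<^sub>C (a * c)) \<and>
     (\<forall>a b c. mult_map (tensor_map (\<lambda>p. mright a (\<kappa> p)) id (T1 \<delta> (b \<otimes>\<^sub>t c)))
        = counit \<delta> b *\<^sub>C (a * c)))"

text \<open>The algebraic direct sum of the matrix algebras \<open>M\<^bsub>n i\<^esub>(\<complex>)\<close>, \<open>i \<in> I\<close>.\<close>

definition matrix_direct_sum :: "'i set \<Rightarrow> ('i \<Rightarrow> nat) \<Rightarrow> ('i \<Rightarrow> complex mat) set" where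
  "matrix_direct_sum I n = {f \<in> \<Pi>\<^sub>E i\<in>I. carrier_mat (n i) (n i). finite {i \<in> I. f i \<noteq> 0\<^sub>m (n i) (n i)}}"

text \<open>The summands are non-zero, so the index set can be taken to be a subset of the algebra itself
  (indexing every summand by its unit). The index set is non-empty: the zero algebra is excluded.\<close>

definition direct_sum_of_matrix_algebras :: "'a::complex_algebra itself \<Rightarrow> bool" where
  "direct_sum_of_matrix_algebras _ \<longleftrightarrow>
     (\<exists>(I::'a set) n (\<phi> :: 'a \<Rightarrow> 'a \<Rightarrow> complex mat).
        I \<noteq> {} \<and> (\<forall>i\<in>I. 0 < n i) \<and> bij_betw \<phi> UNIV (matrix_direct_sum I n) \<and>
        (\<forall>a b. \<forall>i\<in>I. \<phi> (a + b) i = \<phi> a i + \<phi> b i) \<and>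
        (\<forall>c a. \<forall>i\<in>I. \<phi> (c *\<^sub>C a) i = c \<cdot>\<^sub>m \<phi> a i) \<and>
        (\<forall>a b. \<forall>i\<in>I. \<phi> (a * b) i = \<phi> a i * \<phi> b i))"

definition discrete_quantum_group :: "('a::complex_star_algebra \<Rightarrow> ('a, 'a) tensor multiplier) \<Rightarrow> bool" where
  "discrete_quantum_group \<delta> \<longleftrightarrow>
     multiplier_hopf_star_algebra \<delta> \<and> direct_sum_of_matrix_algebras TYPE('a)"


section \<open>Hopf algebras and the algebra \<open>AP\<close>\<close>

definition hopf_algebra :: "('b::complex_unital_algebra \<Rightarrow> ('b, 'b) tensor) \<Rightarrow> ('b \<Rightarrow> complex) \<Rightarrow> ('b \<Rightarrow> 'b) \<Rightarrow> bool" where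
  "hopf_algebra \<delta> \<epsilon> \<kappa> \<longleftrightarrow>
     alg_hom \<delta> \<and> \<delta> 1 = 1 \<and> alg_hom \<epsilon> \<and> \<epsilon> 1 = 1 \<and> clinear \<kappa> \<and>
     (\<forall>b. tensor_assoc (tensor_map \<delta> id (\<delta> b)) = tensor_map id \<delta> (\<delta> b)) \<and>
     (\<forall>b. slice_left \<epsilon> (\<delta> b) = b) \<and> (\<forall>b. slice_right \<epsilon> (\<delta> b) = b) \<and>
     (\<forall>b. mult_map (tensor_map \<kappa> id (\<delta> b)) = \<epsilon> b *\<^sub>C 1) \<and>
     (\<forall>b. mult_map (tensor_map id \<kappa> (\<delta> b)) = \<epsilon> b *\<^sub>C 1)"

definition AP :: "('a::complex_algebra \<Rightarrow> ('a, 'a) tensor multiplier) \<Rightarrow> 'a multiplier set" where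
  "AP \<delta> = {x. extend_hom \<delta> x \<in> range multiplier_tensor}"

text \<open>The structure maps of the Hopf algebra \<open>AP\<close>. The value of the comultiplication is \<open>\<delta>(x)\<close>
  viewed in \<open>AP \<otimes> AP \<subseteq> M(A) \<otimes> M(A)\<close>.\<close>

definition AP_comult :: "('a::complex_algebra \<Rightarrow> ('a, 'a) tensor multiplier)
    \<Rightarrow> 'a multiplier \<Rightarrow> ('a multiplier, 'a multiplier) tensor" where
  "AP_comult \<delta> x = (THE t. t \<in> tensor_subspace (AP \<delta>) (AP \<delta>) \<and> multiplier_tensor t = extend_hom \<delta> x)"

definition AP_counit :: "('a::complex_algebra \<Rightarrow> ('a, 'a) tensor multiplier) \<Rightarrow> 'a multiplier \<Rightarrow> complex" where
  "AP_counit \<delta> = restrict (extend_hom (counit \<delta>)) (AP \<delta>)"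

definition AP_coinverse :: "('a::complex_algebra \<Rightarrow> ('a, 'a) tensor multiplier) \<Rightarrow> 'a multiplier \<Rightarrow> 'a multiplier" where
  "AP_coinverse \<delta> = restrict (extend_antihom (coinverse \<delta>)) (AP \<delta>)"

text \<open>Homomorphisms from a Hopf algebra on a type to a Hopf algebra whose underlying algebra is a
  unital subalgebra \<open>K\<close> of an ambient algebra.\<close>

definition hopf_hom_into ::
  "('b::complex_unital_algebra \<Rightarrow> ('b, 'b) tensor) \<Rightarrow> ('b \<Rightarrow> complex) \<Rightarrow> ('b \<Rightarrow> 'b) \<Rightarrow>
   'c::complex_unital_algebra set \<Rightarrow> ('c \<Rightarrow> ('c, 'c) tensor) \<Rightarrow> ('c \<Rightarrow> complex) \<Rightarrow> ('c \<Rightarrow> 'c) \<Rightarrow>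
   ('b \<Rightarrow> 'c) \<Rightarrow> bool" where
  "hopf_hom_into \<delta>\<^sub>B \<epsilon>\<^sub>B \<kappa>\<^sub>B K \<delta>\<^sub>K \<epsilon>\<^sub>K \<kappa>\<^sub>K f \<longleftrightarrow>
     range f \<subseteq> K \<and> alg_hom f \<and> f 1 = 1 \<and>
     (\<forall>b. \<delta>\<^sub>K (f b) = tensor_map f f (\<delta>\<^sub>B b)) \<and>
     (\<forall>b. \<epsilon>\<^sub>K (f b) = \<epsilon>\<^sub>B b) \<and>
     (\<forall>b. \<kappa>\<^sub>K (f b) = f (\<kappa>\<^sub>B b))"

definition inclusion :: "'a set \<Rightarrow> 'a \<Rightarrow> 'a" where
  "inclusion S = (\<lambda>x\<in>S. x)"

end

theory Submission
  imports Defs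
begin

text \<open>
  The map \<open>\<Phi>'\<close> must be \<open>\<Phi>\<close> itself, and its range lies in \<open>AP\<close> because \<open>\<delta>(\<Phi>(b)) = (\<Phi> \<otimes> \<Phi>)(\<delta>\<^sub>B(b))\<close>.
  What needs an argument is that \<open>\<Phi>\<close> respects counit and coinverse. The character \<open>\<eta> = \<epsilon> \<circ> \<Phi>\<close> of \<open>B\<close>
  satisfies \<open>\<eta> * \<eta> = \<eta>\<close> for the convolution product and has the convolution inverse \<open>\<eta> \<circ> \<kappa>\<^sub>B\<close>, so
  \<open>\<eta> = \<epsilon>\<^sub>B\<close>. Then \<open>\<kappa> \<circ> \<Phi>\<close> is a left and \<open>\<Phi> \<circ> \<kappa>\<^sub>B\<close> a right convolution inverse of \<open>\<Phi>\<close>, so they agree.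

  The counit and the coinverse of \<open>A\<close> are obtained as in Van Daele's theory of multiplier Hopf algebras:
  \<open>\<epsilon>(a)b = \<mu>(T\<^sub>1\<^sup>-\<^sup>1(a \<otimes> b))\<close>, \<open>\<kappa>(a)b = (\<epsilon> \<otimes> id)(T\<^sub>1\<^sup>-\<^sup>1(a \<otimes> b))\<close> and \<open>b\<kappa>(a) = (id \<otimes> \<epsilon>)(T\<^sub>2\<^sup>-\<^sup>1(b \<otimes> a))\<close>.
\<close>


section \<open>Linear maps on tensor products\<close>

lemma clinear_id: "clinear (\<lambda>x. x)" "clinear id"
  by (rule clinearI; simp)+

lemma clinear_compose:
  assumes "clinear f" and "clinear g"
  shows "clinear (\<lambda>x. f (g x))"
  by (rule clinearI) (simp_all add: clinearD[OF assms(1)] clinearD[OF assms(2)])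

lemma clinear_mult_left: "clinear (\<lambda>x. a * x :: 'a::complex_algebra)"
  by (rule clinearI) (simp_all add: distrib_left scaleC_mult_right)

lemma clinear_mult_right: "clinear (\<lambda>x. x * a :: 'a::complex_algebra)"
  by (rule clinearI) (simp_all add: distrib_right scaleC_mult_left)

lemma clinear_pure_tensor_left: "clinear (\<lambda>x. x \<otimes>\<^sub>t b)"
  by (rule clinearI) (simp_all add: pure_tensor_add_left pure_tensor_scale_left)

lemma clinear_pure_tensor_right: "clinear (\<lambda>x. a \<otimes>\<^sub>t x)"
  by (rule clinearI) (simp_all add: pure_tensor_add_right pure_tensor_scale_right)

lemma clinear_mleft_arg: "clinear (\<lambda>m. mleft m a)"
  by (rule clinearI) simp_all

lemma clinear_mright_arg: "clinear (\<lambda>m. mright a m)"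
  by (rule clinearI) simp_all

lemma clinear_sum:
  assumes "clinear f"
  shows "f (sum g A) = (\<Sum>x\<in>A. f (g x))"
  by (induction A rule: infinite_finite_induct) (simp_all add: clinearD[OF assms])

lemma tensor_cases_ext:
  assumes "clinear f" and "clinear g" and "\<And>a b. f (a \<otimes>\<^sub>t b) = g (a \<otimes>\<^sub>t b)"
  shows "f t = g t"
  by (induction t rule: tensor_induct) (simp_all add: assms clinearD[OF assms(1)] clinearD[OF assms(2)])

definition bilinear :: "('a::complex_vector \<Rightarrow> 'b::complex_vector \<Rightarrow> 'c::complex_vector) \<Rightarrow> bool" where
  "bilinear f \<longleftrightarrow> (\<forall>b. clinear (\<lambda>a. f a b)) \<and> (\<forall>a. clinear (f a))"

lemma bilinearI: "(\<And>b. clinear (\<lambda>a. f a b)) \<Longrightarrow> (\<And>a. clinear (f a)) \<Longrightarrow> bilinear f"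
  by (simp add: bilinear_def)

lemma bilinearD:
  assumes "bilinear f"
  shows "clinear (\<lambda>a. f a b)" and "clinear (f a)"
    and "f (a + a') b = f a b + f a' b" and "f (c *\<^sub>C a) b = c *\<^sub>C f a b"
    and "f a (b + b') = f a b + f a b'" and "f a (c *\<^sub>C b) = c *\<^sub>C f a b"
  proof -
  show 1: "clinear (\<lambda>a. f a b)" and 2: "clinear (f a)" for a b using assms by (auto simp: bilinear_def)
  show "f (a + a') b = f a b + f a' b" "f (c *\<^sub>C a) b = c *\<^sub>C f a b"
    "f a (b + b') = f a b + f a b'" "f a (c *\<^sub>C b) = c *\<^sub>C f a b"
    using clinearD(1,2)[OF 1] clinearD(1,2)[OF 2] by simp_all
qed

lemma bilinear_balanced: "bilinear f \<Longrightarrow> balanced f"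
  by (rule balancedI) (simp_all add: bilinearD(3-6)[of f])

lemma tensor_lift_bilinear [simp]: "bilinear f \<Longrightarrow> tensor_lift f (a \<otimes>\<^sub>t b) = f a b"
  by (simp add: bilinear_balanced)

lemma clinear_tensor_lift:
  assumes "bilinear f"
  shows "clinear (tensor_lift f)"
  using tensor_lift_scaleC[where \<sigma> = "\<lambda>c. c", OF bilinear_balanced[OF assms] bilinearD(4)[OF assms]]
  by (intro clinearI) (simp_all add: bilinear_balanced[OF assms])

lemma bilinear_mult: "bilinear ((*) :: 'a::complex_algebra \<Rightarrow> _)"
  by (intro bilinearI clinear_mult_left clinear_mult_right)

lemma mult_map_pure [simp]: "mult_map (a \<otimes>\<^sub>t b) = a * b"
  by (simp add: mult_map_def bilinear_mult)

lemma clinear_mult_map: "clinear mult_map"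
  by (simp add: mult_map_def clinear_tensor_lift bilinear_mult)

lemma bilinear_slice_right:
  assumes "clinear f"
  shows "bilinear (\<lambda>a b. f b *\<^sub>C a)"
  by (intro bilinearI; rule clinearI)
    (simp_all add: clinearD[OF assms] scaleC_complex_def scaleC_add_right scaleC_add_left scaleC_scaleC mult.commute)

lemma bilinear_slice_left:
  assumes "clinear f"
  shows "bilinear (\<lambda>a b. f a *\<^sub>C b)"
  by (intro bilinearI; rule clinearI)
    (simp_all add: clinearD[OF assms] scaleC_complex_def scaleC_add_right scaleC_add_left scaleC_scaleC mult.commute)

lemma slice_right_pure [simp]: "clinear f \<Longrightarrow> slice_right f (a \<otimes>\<^sub>t b) = f b *\<^sub>C a"
  by (simp add: slice_right_def bilinear_slice_right)

lemma slice_left_pure [simp]: "clinear f \<Longrightarrow> slice_left f (a \<otimes>\<^sub>t b) = f a *\<^sub>C b"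
  by (simp add: slice_left_def bilinear_slice_left)

lemma clinear_slice_right: "clinear f \<Longrightarrow> clinear (slice_right f)"
  unfolding slice_right_def by (intro clinear_tensor_lift bilinear_slice_right)

lemma clinear_slice_left: "clinear f \<Longrightarrow> clinear (slice_left f)"
  unfolding slice_left_def by (intro clinear_tensor_lift bilinear_slice_left)

lemma clinear_tensor_assoc: "clinear (tensor_assoc :: (('a::complex_vector, 'b::complex_vector) tensor, 'c::complex_vector) tensor \<Rightarrow> _)"
proof -
  have 1: "bilinear (\<lambda>(a::'a) (b::'b). a \<otimes>\<^sub>t (b \<otimes>\<^sub>t (c::'c)))" for c
    by (intro bilinearI clinear_pure_tensor_left clinear_compose[OF clinear_pure_tensor_right clinear_pure_tensor_left])
  \<comment> \<open>Linearity in the parameter \<open>c\<close> of a lifted map can only be read off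
    on pure tensors, hence the induction on \<open>t\<close>.\<close>
  have 2: "clinear (\<lambda>c. tensor_lift (\<lambda>(a::'a) (b::'b). a \<otimes>\<^sub>t (b \<otimes>\<^sub>t (c::'c))) t)" for t
  proof (induction t rule: tensor_induct)
    case zero
    show ?case by (rule clinearI) (simp_all add: clinearD[OF clinear_tensor_lift[OF 1]])
  next
    case (pure a b)
    show ?case by (simp add: 1) (rule clinear_compose[OF clinear_pure_tensor_right clinear_pure_tensor_right])
  next
    case (add x y)
    then show ?case
      by (intro clinearI) (simp_all add: clinearD[OF clinear_tensor_lift[OF 1]] clinearD[OF add(1)]
          clinearD[OF add(2)] scaleC_add_right ac_simps)
  qed
  show ?thesis
    unfolding tensor_assoc_def by (intro clinear_tensor_lift bilinearI 1 2)
qed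

lemma tensor_map_compose:
  assumes "clinear f" "clinear g" "clinear f'" "clinear g'"
  shows "tensor_map f g (tensor_map f' g' t) = tensor_map (\<lambda>x. f (f' x)) (\<lambda>x. g (g' x)) t"
  by (rule tensor_cases_ext[where t = t])
    (simp_all add: assms clinear_compose[of f f'] clinear_compose[of g g'] clinear_tensor_map
      clinear_compose[OF clinear_tensor_map[of f g] clinear_tensor_map[of f' g']])

lemma clinear_mult_map_tensor_map:
  assumes "clinear f" "clinear g"
  shows "clinear (\<lambda>t. mult_map (tensor_map f g t))"
  by (rule clinear_compose[OF clinear_mult_map clinear_tensor_map[OF assms]])

lemma tensor_map_linear:
  assumes "clinear f" and "clinear g"
  shows "tensor_map f g (x + y) = tensor_map f g x + tensor_map f g y"
    and "tensor_map f g (c *\<^sub>C x) = c *\<^sub>C tensor_map f g x" and "tensor_map f g 0 = 0"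
  by (rule clinearD[OF clinear_tensor_map[OF assms]])+

lemma slice_left_linear:
  assumes "clinear f"
  shows "slice_left f (x + y) = slice_left f x + slice_left f y"
    and "slice_left f (c *\<^sub>C x) = c *\<^sub>C slice_left f x" and "slice_left f 0 = 0"
  by (rule clinearD[OF clinear_slice_left[OF assms]])+

lemma slice_right_linear:
  assumes "clinear f"
  shows "slice_right f (x + y) = slice_right f x + slice_right f y"
    and "slice_right f (c *\<^sub>C x) = c *\<^sub>C slice_right f x" and "slice_right f 0 = 0"
  by (rule clinearD[OF clinear_slice_right[OF assms]])+

lemmas mult_map_linear = clinearD(1-3)[OF clinear_mult_map]
lemmas tensor_assoc_linear = clinearD(1-3)[OF clinear_tensor_assoc]
lemmas linear_simps = tensor_map_linear slice_left_linear slice_right_linear mult_map_linear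
  tensor_assoc_linear clinear_id clinear_mult_left clinear_mult_right clinear_pure_tensor_left
  clinear_pure_tensor_right tensor_assoc_pure scaleC_add_right distrib_left distrib_right
  clinear_mleft clinear_mright


section \<open>Separation of tensors\<close>

text \<open>A Hamel basis, obtained by extending the empty independent set; \<open>coord e\<close>
  is the coordinate functional of the basis vector \<open>e\<close>.\<close>

definition the_basis :: "'a::complex_vector set" where
  "the_basis = complex_vector.extend_basis {}"

definition coord :: "'a::complex_vector \<Rightarrow> 'a \<Rightarrow> complex" where
  "coord e v = complex_vector.representation the_basis v e"

lemma the_basis: "complex_vector.independent the_basis" "complex_vector.span the_basis = UNIV"
  by (simp_all add: the_basis_def complex_vector.independent_extend_basis
      complex_vector.span_extend_basis complex_vector.independent_empty)

lemma clinear_coord: "clinear (coord e)"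
  by (rule clinearI) (simp_all add: coord_def the_basis complex_vector.representation_add
      complex_vector.representation_scale scaleC_complex_def)

text \<open>Only finitely many coordinates are nonzero. Allowing every finite \<open>G\<close> above
  the support lets the expansions of several vectors be taken over a common index set.\<close>

lemma coord_expansion:
  obtains F where "finite F" and "\<And>G. finite G \<Longrightarrow> F \<subseteq> G \<Longrightarrow> v = (\<Sum>e\<in>G. coord e v *\<^sub>C e)"
proof
  let ?F = "{e. coord e v \<noteq> 0}"
  show "finite ?F" unfolding coord_def by (rule complex_vector.finite_representation)
  show "v = (\<Sum>e\<in>G. coord e v *\<^sub>C e)" if "finite G" "?F \<subseteq> G" for G
  proof -
    have "(\<Sum>e\<in>G. coord e v *\<^sub>C e) = (\<Sum>e\<in>?F. coord e v *\<^sub>C e)"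
      by (rule sum.mono_neutral_right) (use that in auto)
    also have "\<dots> = v"
      unfolding coord_def by (rule complex_vector.sum_nonzero_representation_eq) (simp_all add: the_basis)
    finally show ?thesis by simp
  qed
qed

lemma functionals_separate:
  assumes "\<And>\<omega>. clinear \<omega> \<Longrightarrow> \<omega> v = (0::complex)"
  shows "v = 0"
proof -
  obtain F where "finite F" "\<And>G. finite G \<Longrightarrow> F \<subseteq> G \<Longrightarrow> v = (\<Sum>e\<in>G. coord e v *\<^sub>C e)"
    by (rule coord_expansion[of v]) blast
  then have "v = (\<Sum>e\<in>F. coord e v *\<^sub>C e)" by blast
  then show ?thesis by (simp add: assms clinear_coord)
qed

text \<open>The coefficients of \<open>t\<close> with respect to the basis of the second factor are
  its slices, by expansion of the second leg of each pure tensor. The freedom in \<open>G\<close> is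
  what makes sums work: both summands are expanded over the same set.\<close>

lemma tensor_expansion:
  "\<exists>F. finite F \<and> (\<forall>G. finite G \<longrightarrow> F \<subseteq> G \<longrightarrow> t = (\<Sum>e\<in>G. slice_right (coord e) t \<otimes>\<^sub>t e))"
proof (induction t rule: tensor_induct)
  case zero
  show ?case by (rule exI[of _ "{}"]) (simp add: clinearD[OF clinear_slice_right] clinear_coord)
next
  case (pure a b)
  obtain F where F: "finite F" "\<And>G. finite G \<Longrightarrow> F \<subseteq> G \<Longrightarrow> b = (\<Sum>e\<in>G. coord e b *\<^sub>C e)"
    by (rule coord_expansion[of b]) blast
  have "a \<otimes>\<^sub>t b = (\<Sum>e\<in>G. slice_right (coord e) (a \<otimes>\<^sub>t b) \<otimes>\<^sub>t e)" if "finite G" "F \<subseteq> G" for G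
  proof -
    have "a \<otimes>\<^sub>t b = a \<otimes>\<^sub>t (\<Sum>e\<in>G. coord e b *\<^sub>C e)" using F that by metis
    also have "\<dots> = (\<Sum>e\<in>G. slice_right (coord e) (a \<otimes>\<^sub>t b) \<otimes>\<^sub>t e)"
      by (simp add: clinear_coord clinear_sum[OF clinear_pure_tensor_right] pure_tensor_scale_left pure_tensor_scale_right)
    finally show ?thesis .
  qed
  with F(1) show ?case by blast
next
  case (add x y)
  from add(1) obtain F where F: "finite F"
    and x: "\<And>G. finite G \<Longrightarrow> F \<subseteq> G \<Longrightarrow> x = (\<Sum>e\<in>G. slice_right (coord e) x \<otimes>\<^sub>t e)"
    by blast
  from add(2) obtain F' where F': "finite F'"
    and y: "\<And>G. finite G \<Longrightarrow> F' \<subseteq> G \<Longrightarrow> y = (\<Sum>e\<in>G. slice_right (coord e) y \<otimes>\<^sub>t e)"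
    by blast
  have "x + y = (\<Sum>e\<in>G. slice_right (coord e) (x + y) \<otimes>\<^sub>t e)" if "finite G" "F \<union> F' \<subseteq> G" for G
    unfolding clinearD(1)[OF clinear_slice_right[OF clinear_coord]] pure_tensor_add_left sum.distrib
    by (rule arg_cong2[where f = "(+)"]; intro x y) (use that in auto)
  moreover have "finite (F \<union> F')" using F F' by simp
  ultimately show ?case by blast
qed

lemma slices_separate:
  assumes "\<And>\<psi>. clinear \<psi> \<Longrightarrow> slice_right \<psi> t = 0"
  shows "t = 0"
proof -
  obtain F where "t = (\<Sum>e\<in>F. slice_right (coord e) t \<otimes>\<^sub>t e)"
    using tensor_expansion[of t] by blast
  also have "\<dots> = 0" by (simp add: assms clinear_coord)
  finally show ?thesis .
qed

text \<open>For a functional \<omega>, the maps \<open>g j\<close> kill the slice of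
  \<open>t\<close> along \<open>\<omega> \<circ> f i\<close>, so this slice is 0. Pairing it with
  \<psi> gives \<omega>(\<open>f i\<close>(\<open>slice_right\<close> \<psi> t)) = 0, so every slice
  of \<open>t\<close> vanishes. This is the common source of non degeneracy of the product on a
  tensor product and of injectivity of M(A) \<otimes> M(B) \<rightarrow> M(A \<otimes> B).\<close>

lemma tensor_maps_separate:
  fixes f :: "'i \<Rightarrow> 'a::complex_vector \<Rightarrow> 'b::complex_vector"
    and g :: "'j \<Rightarrow> 'c::complex_vector \<Rightarrow> 'd::complex_vector"
  assumes f: "\<And>i. clinear (f i)" and g: "\<And>j. clinear (g j)"
    and f_inj: "\<And>v. (\<And>i. f i v = 0) \<Longrightarrow> v = 0" and g_inj: "\<And>w. (\<And>j. g j w = 0) \<Longrightarrow> w = 0"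
    and 0: "\<And>i j. tensor_map (f i) (g j) t = 0"
  shows "t = 0"
proof (rule slices_separate)
  fix \<psi> :: "'c \<Rightarrow> complex" assume \<psi>: "clinear \<psi>"
  show "slice_right \<psi> t = 0"
  proof (rule f_inj, rule functionals_separate)
    fix i and \<omega> :: "'b \<Rightarrow> complex" assume \<omega>: "clinear \<omega>"
    have \<omega>f: "clinear (\<lambda>v. \<omega> (f i v))" by (rule clinear_compose[OF \<omega> f])
    have "slice_left (\<lambda>v. \<omega> (f i v)) t = 0"
    proof (rule g_inj)
      fix j
      have "g j (slice_left (\<lambda>v. \<omega> (f i v)) t) = slice_left \<omega> (tensor_map (f i) (g j) t)"
        by (rule tensor_cases_ext[where t = t])
          (simp_all add: f g \<omega> \<omega>f clinear_compose[OF g clinear_slice_left]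
            clinear_compose[OF clinear_slice_left clinear_tensor_map] clinearD(2)[OF g])
      then show "g j (slice_left (\<lambda>v. \<omega> (f i v)) t) = 0"
        by (simp add: 0 clinearD[OF clinear_slice_left[OF \<omega>]])
    qed
    moreover have "\<omega> (f i (slice_right \<psi> t)) = \<psi> (slice_left (\<lambda>v. \<omega> (f i v)) t)"
      by (rule tensor_cases_ext[where t = t])
        (simp_all add: \<psi> \<omega>f clinear_compose[OF \<psi> clinear_slice_left] clinearD(2)[OF f]
          clinear_compose[OF \<omega>f clinear_slice_right] clinearD(2)[OF \<psi>] clinearD(2)[OF \<omega>] scaleC_complex_def)
    ultimately show "\<omega> (f i (slice_right \<psi> t)) = 0" by (simp add: clinearD[OF \<psi>])
  qed
qed

lemma ex_functional:
  fixes v :: "'a::complex_vector"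
  assumes "v \<noteq> 0"
  obtains \<omega> :: "'a \<Rightarrow> complex" where "clinear \<omega>" and "\<omega> v = 1"
proof -
  obtain \<omega> :: "'a \<Rightarrow> complex" where \<omega>: "clinear \<omega>" "\<omega> v \<noteq> 0"
    using functionals_separate[of v] assms by blast
  have "clinear (\<lambda>x. \<omega> x / \<omega> v)"
    by (rule clinearI) (simp_all add: clinearD[OF \<omega>(1)] add_divide_distrib scaleC_complex_def)
  with \<omega>(2) that[of "\<lambda>x. \<omega> x / \<omega> v"] show thesis by simp
qed

lemma pure_tensor_cancel_right:
  fixes b :: "'b::complex_vector"
  assumes "a \<otimes>\<^sub>t b = a' \<otimes>\<^sub>t b" and "b \<noteq> 0"
  shows "a = a'"
proof -
  obtain \<omega> :: "'b \<Rightarrow> complex" where "clinear \<omega>" "\<omega> b = 1" using ex_functional[OF assms(2)] .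
  with arg_cong[OF assms(1), of "slice_right \<omega>"] show ?thesis by (simp add: scaleC_one)
qed


section \<open>Multipliers\<close>

lemma nondegenerate_productD:
  assumes "nondegenerate_product TYPE('a::complex_algebra)"
  shows "(\<And>b. a * b = 0) \<Longrightarrow> a = (0::'a)" and "(\<And>b. b * a = 0) \<Longrightarrow> a = (0::'a)"
  using assms unfolding nondegenerate_product_def by blast+

text \<open>Since (am)b = a(mb), the left action determines the right one when the product is non
  degenerate.\<close>

lemma multiplier_eqI_left:
  assumes nd: "nondegenerate_product TYPE('a::complex_algebra)" and eq: "\<And>a. mleft m a = mleft n (a::'a)"
  shows "m = n"
proof (rule multiplier_eqI[OF eq])
  fix a
  have "(mright a m - mright a n) * b = 0" for b by (simp add: left_diff_distrib mright_mult eq)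
  then show "mright a m = mright a n" using nondegenerate_productD(1)[OF nd] by (metis eq_iff_diff_eq_0)
qed

lemma multiplier_eqI_right:
  assumes nd: "nondegenerate_product TYPE('a::complex_algebra)" and eq: "\<And>a. mright a m = mright (a::'a) n"
  shows "m = n"
proof (rule multiplier_eqI_left[OF nd])
  fix a
  have "b * (mleft m a - mleft n a) = 0" for b by (simp add: right_diff_distrib eq flip: mright_mult)
  then show "mleft m a = mleft n a" using nondegenerate_productD(2)[OF nd] by (metis eq_iff_diff_eq_0)
qed

lemma embed_inject:
  assumes nd: "nondegenerate_product TYPE('a::complex_algebra)"
  shows "inj (embed :: 'a \<Rightarrow> _)"
proof (rule injI)
  fix a b :: 'a assume "embed a = embed b"
  then have "(a - b) * c = 0" for c by (metis embed_simps(1) left_diff_distrib eq_iff_diff_eq_0)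
  then show "a = b" using nondegenerate_productD(1)[OF nd] by (metis eq_iff_diff_eq_0)
qed

lemma clinear_embed: "clinear embed"
  by (rule clinearI)
    (auto intro!: multiplier_eqI simp: algebra_simps scaleC_mult_left scaleC_mult_right)

text \<open>The algebra is a two-sided ideal in its multiplier algebra, because the left action of a
  multiplier commutes with right multiplication.\<close>

lemma mult_embed:
  assumes nd: "nondegenerate_product TYPE('a::complex_algebra)"
  shows "m * embed a = embed (mleft m (a::'a))" and "embed a * m = embed (mright a m)"
proof -
  have l: "mleft m (x * y) = mleft m x * y" for x y
  proof -
    have "z * (mleft m (x * y) - mleft m x * y) = 0" for z
      by (simp add: right_diff_distrib mult.assoc[symmetric] flip: mright_mult)
    then show ?thesis using nondegenerate_productD(2)[OF nd] by (metis eq_iff_diff_eq_0)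
  qed
  show "m * embed a = embed (mleft m a)" "embed a * m = embed (mright a m)"
    by (rule multiplier_eqI_left[OF nd]; simp add: l mright_mult)+
qed


section \<open>Extension of maps to the multiplier algebra\<close>

text \<open>Used to define the two actions of a multiplier on an algebra that is known only as a
  span of products.\<close>

lemma factor_through_surjection:
  assumes P: "clinear P" and Q: "clinear Q" and surj: "surj P" and ker: "\<And>t. P t = 0 \<Longrightarrow> Q t = 0"
  shows "\<exists>L. clinear L \<and> (\<forall>t. L (P t) = Q t)"
proof -
  have eq: "Q t = Q s" if "P t = P s" for t s
  proof -
    have "P (t - s) = 0" using that by (simp add: clinearD[OF P])
    from ker[OF this] show ?thesis by (simp add: clinearD[OF Q])
  qed
  define L where "L x = Q (inv_into UNIV P x)" for x
  have L: "L (P t) = Q t" for t unfolding L_def by (rule eq) (simp add: surj f_inv_into_f)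
  have "clinear L"
  proof (rule clinearI)
    fix x y c
    obtain s t where "x = P s" "y = P t" using surj by (metis surjD)
    then show "L (x + y) = L x + L y" and "L (c *\<^sub>C x) = c *\<^sub>C L x"
      by (simp_all add: L clinearD[OF Q] flip: clinearD[OF P])
  qed
  with L show ?thesis by blast
qed

lemma surj_if_span:
  assumes "clinear P" and "complex_vector.span S = UNIV" and "S \<subseteq> range P"
  shows "surj P"
proof -
  have "complex_vector.subspace (range P)"
    using clinearD(1-3)[OF assms(1), symmetric] by (intro complex_vector.subspaceI) (auto 4 3)
  with assms show ?thesis using complex_vector.span_minimal by blast
qed

text \<open>Non degeneracy is separated from multiplicativity, so that the construction of
  extensions serves homomorphisms and antihomomorphisms alike.\<close>

definition nondegenerate_map :: "('b::complex_algebra \<Rightarrow> 'a::complex_algebra multiplier) \<Rightarrow> bool" where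
  "nondegenerate_map f \<longleftrightarrow> clinear f \<and>
     complex_vector.span {mleft (f b) a |b a. True} = UNIV \<and>
     complex_vector.span {mright a (f b) |b a. True} = UNIV"

lemma nondegenerate_hom_iff: "nondegenerate_hom f \<longleftrightarrow> alg_hom f \<and> nondegenerate_map f"
  by (auto simp: nondegenerate_hom_def nondegenerate_map_def alg_hom_def)

context
  fixes f :: "'b::complex_algebra \<Rightarrow> 'a::complex_algebra multiplier"
  assumes nd: "nondegenerate_product TYPE('a)" and f: "nondegenerate_map f"
begin

lemma map_linear: "clinear f"
  using f by (simp add: nondegenerate_map_def)

lemma bilinear_left_action: "clinear l \<Longrightarrow> bilinear (\<lambda>b a. mleft (f (l b)) a)"
  by (intro bilinearI clinear_mleft clinear_compose[OF clinear_mleft_arg clinear_compose[OF map_linear]])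

lemma bilinear_right_action: "clinear r \<Longrightarrow> bilinear (\<lambda>b a. mright a (f (r b)))"
  by (intro bilinearI clinear_mright clinear_compose[OF clinear_mright_arg clinear_compose[OF map_linear]])

lemma surj_left_action: "surj (tensor_lift (\<lambda>b a. mleft (f b) a))"
proof (rule surj_if_span)
  have 1: "bilinear (\<lambda>b a. mleft (f b) a)" by (rule bilinear_left_action[OF clinear_id(1)])
  show "clinear (tensor_lift (\<lambda>b a. mleft (f b) a))" by (rule clinear_tensor_lift[OF 1])
  show "{mleft (f b) a |b a. True} \<subseteq> range (tensor_lift (\<lambda>b a. mleft (f b) a))"
    using tensor_lift_bilinear[OF 1, symmetric] by blast
  show "complex_vector.span {mleft (f b) a |b a. True} = UNIV"
    using f by (simp add: nondegenerate_map_def)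
qed

lemma surj_right_action: "surj (tensor_lift (\<lambda>b a. mright a (f b)))"
proof (rule surj_if_span)
  have 1: "bilinear (\<lambda>b a. mright a (f b))" by (rule bilinear_right_action[OF clinear_id(1)])
  show "clinear (tensor_lift (\<lambda>b a. mright a (f b)))" by (rule clinear_tensor_lift[OF 1])
  show "{mright a (f b) |b a. True} \<subseteq> range (tensor_lift (\<lambda>b a. mright a (f b)))"
    using tensor_lift_bilinear[OF 1, symmetric] by blast
  show "complex_vector.span {mright a (f b) |b a. True} = UNIV"
    using f by (simp add: nondegenerate_map_def)
qed

text \<open>The elements f(b)a span the algebra, and on them the left action of \<open>m\<close> is
  that of \<open>m * f b\<close> on \<open>a\<close>.\<close>

lemma multiplier_determined:
  assumes "\<And>b. m * f b = n * f b"
  shows "m = n"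
proof (rule multiplier_eqI_left[OF nd])
  fix a
  obtain t where t: "a = tensor_lift (\<lambda>b a. mleft (f b) a) t" using surj_left_action by (metis surjD)
  have 1: "bilinear (\<lambda>b a. mleft (f b) a)" by (rule bilinear_left_action[OF clinear_id(1)])
  have "mleft (m * f b) a = mleft (n * f b) a" for a b by (simp only: assms)
  then show "mleft m a = mleft n a"
    unfolding t by (induction t rule: tensor_induct)
      (simp_all add: 1 clinearD[OF clinear_tensor_lift[OF 1]])
qed

text \<open>The wanted multiplier acts by f(b)a \<mapsto> f(l b)a on the left and by a f(b)
  \<mapsto> a f(r b) on the right. Extending a homomorphism to a multiplier n takes l and r to be b
  \<mapsto> nb and b \<mapsto> bn; for an antihomomorphism the two are exchanged.\<close>

lemma ex_multiplier:
  assumes l: "clinear l" and r: "clinear r" and lr: "\<And>b c. f c * f (l b) = f (r c) * f b"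
  shows "\<exists>!m. \<forall>b. m * f b = f (l b)"
proof (rule ex_ex1I)
  let ?P = "tensor_lift (\<lambda>b a. mleft (f b) a)" and ?Q = "tensor_lift (\<lambda>b a. mleft (f (l b)) a)"
  let ?P' = "tensor_lift (\<lambda>b a. mright a (f b))" and ?Q' = "tensor_lift (\<lambda>b a. mright a (f (r b)))"
  have bil: "bilinear (\<lambda>b a. mleft (f b) a)" "bilinear (\<lambda>b a. mleft (f (l b)) a)"
    "bilinear (\<lambda>b a. mright a (f b))" "bilinear (\<lambda>b a. mright a (f (r b)))"
    using bilinear_left_action[OF clinear_id(1)] bilinear_left_action[OF l]
      bilinear_right_action[OF clinear_id(1)] bilinear_right_action[OF r] by simp_all
  note lin = bil[THEN clinear_tensor_lift]
  note [simp] = bil lin[THEN clinearD(1)] lin[THEN clinearD(3)]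
  \<comment> \<open>This identity does all the work: with surjectivity of \<open>?P\<close>,
    \<open>?P'\<close> and non degeneracy it makes both actions well defined, and it is also the
    compatibility (bm)a = b(ma) of the two.\<close>
  have balance: "?Q' s * ?P t = ?P' s * ?Q t" for s t
  proof (induction s rule: tensor_induct)
    case (pure b a)
    show ?case
    proof (induction t rule: tensor_induct)
      case (pure b' a')
      have "mright a (f (r b)) * mleft (f b') a' = a * mleft (f (r b) * f b') a'"
        by (simp add: mright_mult)
      also have "\<dots> = mright a (f b) * mleft (f (l b')) a'"
        by (simp add: mright_mult flip: lr)
      finally show ?case by simp
    qed (simp_all add: distrib_left)
  qed (simp_all add: distrib_right)
  have "?Q t = 0" if "?P t = 0" for t
  proof (rule nondegenerate_productD(2)[OF nd])
    fix b
    obtain s where "b = ?P' s" using surj_right_action by (metis surjD)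
    then show "b * ?Q t = 0" using balance[of s t] that by simp
  qed
  then obtain L where L: "clinear L" "\<And>t. L (?P t) = ?Q t"
    using factor_through_surjection[OF lin(1,2) surj_left_action] by blast
  have "?Q' t = 0" if "?P' t = 0" for t
  proof (rule nondegenerate_productD(1)[OF nd])
    fix b
    obtain s where "b = ?P s" using surj_left_action by (metis surjD)
    then show "?Q' t * b = 0" using balance[of t s] that by simp
  qed
  then obtain R where R: "clinear R" "\<And>t. R (?P' t) = ?Q' t"
    using factor_through_surjection[OF lin(3,4) surj_right_action] by blast
  have "R b * a = b * L a" for a b
  proof -
    obtain s t where "b = ?P' s" "a = ?P t"
      using surj_left_action surj_right_action by (metis surjD)
    then show ?thesis using balance[of s t] by (simp add: L R)
  qed
  note mk = mk_multiplier[OF L(1) R(1) this]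
  have "mk_multiplier L R * f b = f (l b)" for b
  proof (rule multiplier_eqI_left[OF nd])
    fix a
    show "mleft (mk_multiplier L R * f b) a = mleft (f (l b)) a"
      using L(2)[of "b \<otimes>\<^sub>t a"] by (simp add: mk)
  qed
  then show "\<exists>m. \<forall>b. m * f b = f (l b)" by blast
qed (metis multiplier_determined)

end

lemma multiplier_determined_right:
  assumes nd: "nondegenerate_product TYPE('a::complex_algebra)" and f: "nondegenerate_map (f :: _ \<Rightarrow> 'a multiplier)"
    and eq: "\<And>b. f b * m = f b * n"
  shows "m = n"
proof (rule multiplier_eqI_right[OF nd])
  fix a
  obtain t where t: "a = tensor_lift (\<lambda>b a. mright a (f b)) t"
    using surj_right_action[OF nd f] by (metis surjD)
  have 1: "bilinear (\<lambda>b a. mright a (f b))" by (rule bilinear_right_action[OF nd f clinear_id(1)])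
  have "mright a (f b * m) = mright a (f b * n)" for a b by (simp only: eq)
  then show "mright a m = mright a n"
    unfolding t by (induction t rule: tensor_induct)
      (simp_all add: 1 clinearD[OF clinear_tensor_lift[OF 1]])
qed

text \<open>F(m) is the unique multiplier with F(m)f(b) = f(mb). Every property of F, and its
  uniqueness, is checked after multiplication by f(b) on the right.\<close>

lemma extend_hom_works:
  fixes f :: "'b::complex_algebra \<Rightarrow> 'a::complex_algebra multiplier"
  assumes nd: "nondegenerate_product TYPE('a)" and ndB: "nondegenerate_product TYPE('b)"
    and f: "nondegenerate_hom f"
  shows "alg_hom (extend_hom f) \<and> extend_hom f 1 = 1 \<and> (\<forall>b. extend_hom f (embed b) = f b)"
proof -
  have fh: "alg_hom f" and fn: "nondegenerate_map f" using f by (auto simp: nondegenerate_hom_iff)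
  then have lin: "clinear f" and mult: "f (a * b) = f a * f b" for a b by (auto simp: alg_hom_def)
  note det = multiplier_determined[OF nd fn]
  have ex: "\<exists>!n. \<forall>b. n * f b = f (mleft m b)" for m
    by (rule ex_multiplier[OF nd fn clinear_mleft clinear_mright[of m]]) (simp add: mright_mult flip: mult)
  define F where "F m = (THE n. \<forall>b. n * f b = f (mleft m b))" for m
  have F: "F m * f b = f (mleft m b)" for m b
    using theI'[OF ex[of m]] by (simp add: F_def)
  have F_alg: "alg_hom F"
    unfolding alg_hom_def
    by (intro conjI clinearI allI; rule det)
      (simp_all add: F distrib_right scaleC_mult_left mult.assoc clinearD[OF lin])
  have F_1: "F 1 = 1" by (rule det) (simp add: F)
  have F_embed: "F (embed b) = f b" for b by (rule det) (simp add: F mult)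
  show ?thesis
    unfolding extend_hom_def
  proof (rule theI[where P = "\<lambda>F. alg_hom F \<and> F 1 = 1 \<and> (\<forall>b. F (embed b) = f b)" and a = F])
    show "alg_hom F \<and> F 1 = 1 \<and> (\<forall>b. F (embed b) = f b)" using F_alg F_1 F_embed by blast
    fix G assume G: "alg_hom G \<and> G 1 = 1 \<and> (\<forall>b. G (embed b) = f b)"
    have "G m = F m" for m
    proof (rule det)
      fix b
      have "G m * f b = G (m * embed b)" using G by (simp add: alg_hom_def)
      also have "\<dots> = f (mleft m b)" using G by (simp add: mult_embed[OF ndB])
      finally show "G m * f b = F m * f b" by (simp add: F)
    qed
    then show "G = F" by blast
  qed
qed

text \<open>The order is reversed: F(m) is the unique multiplier with F(m)f(b) = f(bm).\<close>

lemma extend_antihom_works: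
  fixes f :: "'b::complex_algebra \<Rightarrow> 'a::complex_algebra multiplier"
  assumes nd: "nondegenerate_product TYPE('a)" and ndB: "nondegenerate_product TYPE('b)"
    and fa: "alg_antihom f" and fn: "nondegenerate_map f"
  shows "alg_antihom (extend_antihom f) \<and> extend_antihom f 1 = 1 \<and> (\<forall>b. extend_antihom f (embed b) = f b)"
proof -
  have lin: "clinear f" and mult: "f (a * b) = f b * f a" for a b
    using fa by (auto simp: alg_antihom_def)
  note det = multiplier_determined[OF nd fn]
  have ex: "\<exists>!n. \<forall>b. n * f b = f (mright b m)" for m
    by (rule ex_multiplier[OF nd fn clinear_mright clinear_mleft[of m]]) (simp add: mright_mult flip: mult)
  define F where "F m = (THE n. \<forall>b. n * f b = f (mright b m))" for m
  have F: "F m * f b = f (mright b m)" for m b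
    using theI'[OF ex[of m]] by (simp add: F_def)
  have F_alg: "alg_antihom F"
    unfolding alg_antihom_def
    by (intro conjI clinearI allI; rule det)
      (simp_all add: F distrib_right scaleC_mult_left mult.assoc clinearD[OF lin])
  have F_1: "F 1 = 1" by (rule det) (simp add: F)
  have F_embed: "F (embed b) = f b" for b by (rule det) (simp add: F mult)
  show ?thesis
    unfolding extend_antihom_def
  proof (rule theI[where P = "\<lambda>F. alg_antihom F \<and> F 1 = 1 \<and> (\<forall>b. F (embed b) = f b)" and a = F])
    show "alg_antihom F \<and> F 1 = 1 \<and> (\<forall>b. F (embed b) = f b)" using F_alg F_1 F_embed by blast
    fix G assume G: "alg_antihom G \<and> G 1 = 1 \<and> (\<forall>b. G (embed b) = f b)"
    have "G m = F m" for m
    proof (rule det)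
      fix b
      have "G m * f b = G (embed b * m)" using G by (simp add: alg_antihom_def)
      also have "\<dots> = f (mright b m)" using G by (simp add: mult_embed[OF ndB])
      finally show "G m * f b = F m * f b" by (simp add: F)
    qed
    then show "G = F" by blast
  qed
qed

text \<open>For a character the extension is explicit, F(m) = f(me)/f(e). Independence of the choice
  of \<open>e\<close> is the identity f(me)f(b) = f(mb)f(e), where both sides times f(e) equal
  f((em)e)f(b) up to order.\<close>

lemma extend_character_works:
  fixes f :: "'b::complex_algebra \<Rightarrow> complex"
  assumes ndB: "nondegenerate_product TYPE('b)" and fh: "alg_hom f" and e: "f e \<noteq> 0"
  shows "alg_hom (extend_hom f) \<and> extend_hom f 1 = 1 \<and> (\<forall>b. extend_hom f (embed b) = f b)"
proof -
  have lin: "clinear f" and mult: "f (a * b) = f a * f b" for a b using fh by (auto simp: alg_hom_def)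
  define F where "F m = f (mleft m e) / f e" for m
  have F: "F m * f b = f (mleft m b)" for m b
  proof -
    have "f e * f (mleft m b) = f (mright e m * b)" by (simp add: mright_mult mult)
    also have "\<dots> * f e = f (mright e m * e) * f b" by (simp add: mult)
    also have "\<dots> = f e * (f (mleft m e) * f b)" by (simp add: mright_mult mult)
    finally show ?thesis using e by (simp add: F_def field_simps)
  qed
  have det: "x = y" if "\<And>b. x * f b = y * f b" for x y using that[of e] e by simp
  have F_alg: "alg_hom F"
    unfolding alg_hom_def
    by (intro conjI clinearI allI; rule det)
      (simp_all add: F distrib_right scaleC_mult_left mult.assoc clinearD[OF lin])
  have F_1: "F 1 = 1" by (rule det) (simp add: F)
  have F_embed: "F (embed b) = f b" for b by (rule det) (simp add: F mult)
  show ?thesis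
    unfolding extend_hom_def
  proof (rule theI[where P = "\<lambda>F. alg_hom F \<and> F 1 = 1 \<and> (\<forall>b. F (embed b) = f b)" and a = F])
    show "alg_hom F \<and> F 1 = 1 \<and> (\<forall>b. F (embed b) = f b)" using F_alg F_1 F_embed by blast
    fix G assume G: "alg_hom G \<and> G 1 = 1 \<and> (\<forall>b. G (embed b) = f b)"
    have "G m = F m" for m
    proof (rule det)
      fix b
      have "G m * f b = G (m * embed b)" using G by (simp add: alg_hom_def)
      also have "\<dots> = f (mleft m b)" using G by (simp add: mult_embed[OF ndB])
      finally show "G m * f b = F m * f b" by (simp add: F)
    qed
    then show "G = F" by blast
  qed
qed


section \<open>Tensor products of multipliers\<close>

text \<open>Multiplication by a \<otimes> b is the tensor product of the multiplications by a and by
  b, and these separate points in each factor.\<close>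

lemma nondegenerate_product_tensor:
  assumes A: "nondegenerate_product TYPE('a::complex_algebra)" and B: "nondegenerate_product TYPE('b::complex_algebra)"
  shows "nondegenerate_product TYPE(('a, 'b) tensor)"
proof -
  note A = nondegenerate_productD[OF A] and B = nondegenerate_productD[OF B]
  show ?thesis
    unfolding nondegenerate_product_def
  proof (intro conjI allI impI)
    fix t :: "('a, 'b) tensor" assume t: "\<forall>s. t * s = 0"
    have "tensor_map (\<lambda>x. x * a) (\<lambda>y. y * b) t = t * (a \<otimes>\<^sub>t b)" for a b
      by (rule tensor_cases_ext[where t = t])
        (simp_all add: clinear_mult_right clinear_tensor_map times_tensor_pure)
    with t show "t = 0"
      using tensor_maps_separate[of "\<lambda>a x. x * a" "\<lambda>b y. y * b" t] A(1) B(1)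
      by (simp add: clinear_mult_right)
  next
    fix t :: "('a, 'b) tensor" assume t: "\<forall>s. s * t = 0"
    have "tensor_map (\<lambda>x. a * x) (\<lambda>y. b * y) t = (a \<otimes>\<^sub>t b) * t" for a b
      by (rule tensor_cases_ext[where t = t])
        (simp_all add: clinear_mult_left clinear_tensor_map times_tensor_pure)
    with t show "t = 0"
      using tensor_maps_separate[of "\<lambda>a x. a * x" "\<lambda>b y. b * y" t] A(2) B(2)
      by (simp add: clinear_mult_left)
  qed
qed

lemma bilinear_multiplier_tensor_pure:
  "bilinear (multiplier_tensor_pure :: 'a::complex_algebra multiplier \<Rightarrow> 'b::complex_algebra multiplier \<Rightarrow> _)"
proof -
  have pure: "mleft (multiplier_tensor_pure m n) (a \<otimes>\<^sub>t b) = mleft m a \<otimes>\<^sub>t mleft n b"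
    "mright (a \<otimes>\<^sub>t b) (multiplier_tensor_pure m n) = mright a m \<otimes>\<^sub>t mright b n"
    for m :: "'a multiplier" and n :: "'b multiplier" and a b
    by (simp_all add: multiplier_tensor_pure_simps clinear_mleft clinear_mright)
  note rules = pure pure_tensor_add_left pure_tensor_add_right pure_tensor_scale_left
    pure_tensor_scale_right scaleC_add_right ac_simps
  show ?thesis
  proof (intro bilinearI clinearI multiplier_eqI)
    fix m m' :: "'a multiplier" and n n' :: "'b multiplier" and c and t :: "('a, 'b) tensor"
    show "mleft (multiplier_tensor_pure (m + m') n) t = mleft (multiplier_tensor_pure m n + multiplier_tensor_pure m' n) t"
      by (induction t rule: tensor_induct) (simp_all add: rules)
    show "mright t (multiplier_tensor_pure (m + m') n) = mright t (multiplier_tensor_pure m n + multiplier_tensor_pure m' n)"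
      by (induction t rule: tensor_induct) (simp_all add: rules)
    show "mleft (multiplier_tensor_pure m (n + n')) t = mleft (multiplier_tensor_pure m n + multiplier_tensor_pure m n') t"
      by (induction t rule: tensor_induct) (simp_all add: rules)
    show "mright t (multiplier_tensor_pure m (n + n')) = mright t (multiplier_tensor_pure m n + multiplier_tensor_pure m n')"
      by (induction t rule: tensor_induct) (simp_all add: rules)
    show "mleft (multiplier_tensor_pure (c *\<^sub>C m) n) t = mleft (c *\<^sub>C multiplier_tensor_pure m n) t"
      by (induction t rule: tensor_induct) (simp_all add: rules)
    show "mright t (multiplier_tensor_pure (c *\<^sub>C m) n) = mright t (c *\<^sub>C multiplier_tensor_pure m n)"
      by (induction t rule: tensor_induct) (simp_all add: rules)
    show "mleft (multiplier_tensor_pure m (c *\<^sub>C n)) t = mleft (c *\<^sub>C multiplier_tensor_pure m n) t"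
      by (induction t rule: tensor_induct) (simp_all add: rules)
    show "mright t (multiplier_tensor_pure m (c *\<^sub>C n)) = mright t (c *\<^sub>C multiplier_tensor_pure m n)"
      by (induction t rule: tensor_induct) (simp_all add: rules)
  qed
qed

lemma clinear_multiplier_tensor: "clinear multiplier_tensor"
  unfolding multiplier_tensor_def by (rule clinear_tensor_lift[OF bilinear_multiplier_tensor_pure])

text \<open>Evaluation of the image at a \<otimes> b is the tensor product of the evaluations m
  \<mapsto> ma and n \<mapsto> nb, which separate multipliers. It makes the value of
  \<open>AP_comult\<close> unique.\<close>

lemma inj_multiplier_tensor:
  assumes A: "nondegenerate_product TYPE('a::complex_algebra)" and B: "nondegenerate_product TYPE('b::complex_algebra)"
    and eq: "multiplier_tensor s = multiplier_tensor (t :: ('a multiplier, 'b multiplier) tensor)"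
  shows "s = t"
proof -
  have *: "tensor_map (\<lambda>m. mleft m a) (\<lambda>n. mleft n b) u = mleft (multiplier_tensor u) (a \<otimes>\<^sub>t b)"
    for a b and u :: "('a multiplier, 'b multiplier) tensor"
    by (rule tensor_cases_ext[where t = u])
      (simp_all add: clinear_mleft_arg clinear_tensor_map multiplier_tensor_simps
        clinear_compose[OF clinear_mleft_arg clinear_multiplier_tensor])
  have "s - t = 0"
  proof (rule tensor_maps_separate[of "\<lambda>a m. mleft m a" "\<lambda>b n. mleft n b"])
    show "m = 0" if "\<And>a. mleft m a = 0" for m :: "'a multiplier"
      by (rule multiplier_eqI_left[OF A]) (simp add: that)
    show "n = 0" if "\<And>b. mleft n b = 0" for n :: "'b multiplier"
      by (rule multiplier_eqI_left[OF B]) (simp add: that)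
    show "tensor_map (\<lambda>m. mleft m a) (\<lambda>n. mleft n b) (s - t) = 0" for a b
      by (simp add: * eq clinearD[OF clinear_multiplier_tensor])
  qed (rule clinear_mleft_arg)+
  then show ?thesis by simp
qed


section \<open>Counit and coinverse of a multiplier Hopf algebra\<close>

text \<open>The maps applied to w stand for w(p \<otimes> I), w(I \<otimes> q), (p \<otimes> I)w and
  (I \<otimes> q)w, written without a unit in the algebras.\<close>

lemma tensor_map_mult_simps:
  fixes w :: "('a::complex_algebra, 'b::complex_algebra) tensor"
  shows "tensor_map (\<lambda>z. z * p) (\<lambda>z. z) w * (x \<otimes>\<^sub>t y) = w * ((p * x) \<otimes>\<^sub>t y)"
    and "tensor_map (\<lambda>z. z) (\<lambda>z. z * q) w * (x \<otimes>\<^sub>t y) = w * (x \<otimes>\<^sub>t (q * y))"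
    and "(x \<otimes>\<^sub>t y) * tensor_map (\<lambda>z. p * z) (\<lambda>z. z) w = ((x * p) \<otimes>\<^sub>t y) * w"
    and "(x \<otimes>\<^sub>t y) * tensor_map (\<lambda>z. z) (\<lambda>z. q * z) w = (x \<otimes>\<^sub>t (y * q)) * w"
  by (induction w rule: tensor_induct; simp add: linear_simps times_tensor_pure mult.assoc)+

lemma clinear_the_inv:
  assumes "clinear f" and "bij f"
  shows "clinear (the_inv f)"
proof (rule clinearI)
  fix x y c
  have inj: "inj f" using assms(2) by (simp add: bij_is_inj)
  obtain s t where "x = f s" "y = f t" using assms(2) by (metis bij_is_surj surjD)
  then show "the_inv f (x + y) = the_inv f x + the_inv f y" "the_inv f (c *\<^sub>C x) = c *\<^sub>C the_inv f x"
    by (simp_all add: the_inv_f_f[OF inj] flip: clinearD[OF assms(1)])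
qed

lemma mleft_mult:
  assumes nd: "nondegenerate_product TYPE('a::complex_algebra)"
  shows "mleft m (x * y) = mleft m x * (y::'a)"
  using mult_embed(1)[OF nd, of m x]
  by (metis embed_simps(1) multiplier_simps(11))

lemma mright_mult_left:
  assumes nd: "nondegenerate_product TYPE('a::complex_algebra)"
  shows "mright (x * y) m = x * mright (y::'a) m"
  using mult_embed(2)[OF nd, of y m]
  by (metis embed_simps(2) multiplier_simps(12))

lemma tensor_eqI:
  fixes s t :: "('a::complex_algebra, 'b::complex_algebra) tensor"
  assumes nd: "nondegenerate_product TYPE(('a, 'b) tensor)"
  shows "(\<And>x y. s * (x \<otimes>\<^sub>t y) = t * (x \<otimes>\<^sub>t y)) \<Longrightarrow> s = t"
    and "(\<And>x y. (x \<otimes>\<^sub>t y) * s = (x \<otimes>\<^sub>t y) * t) \<Longrightarrow> s = t"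
proof -
  show "s = t" if "\<And>x y. s * (x \<otimes>\<^sub>t y) = t * (x \<otimes>\<^sub>t y)"
  proof -
    have "(s - t) * u = 0" for u
      by (induction u rule: tensor_induct) (simp_all add: distrib_left left_diff_distrib that)
    then show ?thesis using nondegenerate_productD(1)[OF nd] by (metis eq_iff_diff_eq_0)
  qed
  show "s = t" if "\<And>x y. (x \<otimes>\<^sub>t y) * s = (x \<otimes>\<^sub>t y) * t"
  proof -
    have "u * (s - t) = 0" for u
      by (induction u rule: tensor_induct) (simp_all add: distrib_right right_diff_distrib that)
    then show ?thesis using nondegenerate_productD(2)[OF nd] by (metis eq_iff_diff_eq_0)
  qed
qed

section \<open>The maps \<open>T1\<close> and \<open>T2\<close>, their inverses and the
  comultiplication\<close>

locale multiplier_hopf =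
  fixes \<delta> :: "'a::complex_algebra \<Rightarrow> ('a, 'a) tensor multiplier"
  assumes mha: "multiplier_hopf_algebra \<delta>" and nontrivial: "\<exists>a::'a. a \<noteq> 0"
begin

lemma nd: "nondegenerate_product TYPE('a)"
  using mha by (simp add: multiplier_hopf_algebra_def)

lemma nd2: "nondegenerate_product TYPE(('a, 'a) tensor)"
  by (rule nondegenerate_product_tensor[OF nd nd])

lemma \<delta>_linear: "clinear \<delta>" and \<delta>_mult: "\<delta> (a * b) = \<delta> a * \<delta> b"
  using mha by (simp_all add: multiplier_hopf_algebra_def alg_hom_def)

lemma embed_the_inv: "m \<in> range embed \<Longrightarrow> embed (the_inv embed m :: ('a, 'a) tensor) = m"
  by (rule f_the_inv_into_f[OF embed_inject[OF nd2]])

lemma the_inv_embed: "the_inv embed (embed x :: ('a, 'a) tensor multiplier) = x"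
  by (rule the_inv_f_f[OF embed_inject[OF nd2]])

lemma bilinear_the_inv_embed:
  assumes "bilinear f" and "\<And>a b. f a b \<in> range embed"
  shows "bilinear (\<lambda>a b. the_inv embed (f a b) :: ('a, 'a) tensor)"
proof -
  have *: "the_inv embed m = x" if "embed x = m" for m and x :: "('a, 'a) tensor"
    using that the_inv_embed by blast
  show ?thesis
    by (intro bilinearI clinearI; rule *)
      (simp_all add: clinearD[OF clinear_embed] embed_the_inv assms bilinearD(3-6)[OF assms(1)])
qed

lemma bilinear_T1_mult: "bilinear (T1_mult \<delta>)"
  unfolding T1_mult_def
  by (intro bilinearI clinearI)
    (simp_all add: clinearD[OF \<delta>_linear] clinearD[OF clinear_embed] clinearD[OF clinear_multiplier_tensor]
      distrib_left distrib_right scaleC_mult_left scaleC_mult_right pure_tensor_add_right pure_tensor_scale_right)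

lemma bilinear_T2_mult: "bilinear (T2_mult \<delta>)"
  unfolding T2_mult_def
  by (intro bilinearI clinearI)
    (simp_all add: clinearD[OF \<delta>_linear] clinearD[OF clinear_embed] clinearD[OF clinear_multiplier_tensor]
      distrib_left distrib_right scaleC_mult_left scaleC_mult_right pure_tensor_add_left pure_tensor_scale_left)

lemma T_range: "T1_mult \<delta> a b \<in> range embed" "T2_mult \<delta> a b \<in> range embed"
  using mha by (simp_all add: multiplier_hopf_algebra_def)

lemma clinear_T1: "clinear (T1 \<delta>)"
  unfolding T1_def by (intro clinear_tensor_lift bilinear_the_inv_embed bilinear_T1_mult T_range)

lemma clinear_T2: "clinear (T2 \<delta>)"
  unfolding T2_def by (intro clinear_tensor_lift bilinear_the_inv_embed bilinear_T2_mult T_range)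

lemma embed_T1: "embed (T1 \<delta> (a \<otimes>\<^sub>t b)) = \<delta> a * multiplier_tensor (1 \<otimes>\<^sub>t embed b)"
  by (simp add: T1_def bilinear_the_inv_embed bilinear_T1_mult T_range embed_the_inv) (simp add: T1_mult_def)

lemma embed_T2: "embed (T2 \<delta> (a \<otimes>\<^sub>t b)) = multiplier_tensor (embed a \<otimes>\<^sub>t 1) * \<delta> b"
  by (simp add: T2_def bilinear_the_inv_embed bilinear_T2_mult T_range embed_the_inv) (simp add: T2_mult_def)

lemma bij_T: "bij (T1 \<delta>)" "bij (T2 \<delta>)"
  using mha by (simp_all add: multiplier_hopf_algebra_def)

abbreviation "T1i \<equiv> the_inv (T1 \<delta>)"
abbreviation "T2i \<equiv> the_inv (T2 \<delta>)"

lemma T_inv [simp]: "T1 \<delta> (T1i w) = w" "T1i (T1 \<delta> u) = u" "T2 \<delta> (T2i w) = w" "T2i (T2 \<delta> u) = u"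
  using bij_T by (auto simp: bij_def the_inv_f_f intro: f_the_inv_into_f)

lemma clinear_Ti: "clinear T1i" "clinear T2i"
  by (intro clinear_the_inv clinear_T1 clinear_T2 bij_T)+

lemmas T_linear = clinearD(1-3)[OF clinear_T1] clinearD(1-3)[OF clinear_T2]
  clinearD(1-3)[OF clinear_Ti(1)] clinearD(1-3)[OF clinear_Ti(2)]

text \<open>\<open>T1\<close> is given through the embedding into M(A \<otimes> A), so it is
  computed by letting its values act on pure tensors.\<close>

lemma T1_times: "T1 \<delta> (a \<otimes>\<^sub>t b) * (x \<otimes>\<^sub>t y) = mleft (\<delta> a) (x \<otimes>\<^sub>t (b * y))"
proof -
  have "mleft (embed (T1 \<delta> (a \<otimes>\<^sub>t b))) (x \<otimes>\<^sub>t y) = mleft (\<delta> a) (x \<otimes>\<^sub>t (b * y))"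
    unfolding embed_T1 by (simp add: multiplier_tensor_simps)
  then show ?thesis by simp
qed

lemma times_T2: "(x \<otimes>\<^sub>t y) * T2 \<delta> (a \<otimes>\<^sub>t b) = mright ((x * a) \<otimes>\<^sub>t y) (\<delta> b)"
proof -
  have "mright (x \<otimes>\<^sub>t y) (embed (T2 \<delta> (a \<otimes>\<^sub>t b))) = mright ((x * a) \<otimes>\<^sub>t y) (\<delta> b)"
    unfolding embed_T2 by (simp add: multiplier_tensor_simps)
  then show ?thesis by simp
qed

text \<open>This is \<delta>(a)(p \<otimes> q) = \<delta>(a)(I \<otimes> q)(p \<otimes> I), which
  recovers \<delta> from \<open>T1\<close>.\<close>

lemma comult_left: "mleft (\<delta> a) (p \<otimes>\<^sub>t q) = tensor_map (\<lambda>z. z * p) (\<lambda>z. z) (T1 \<delta> (a \<otimes>\<^sub>t q))"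
  by (rule tensor_eqI(1)[OF nd2])
    (simp add: tensor_map_mult_simps T1_times times_tensor_pure flip: mleft_mult[OF nd2])

lemma comult_right: "mright (p \<otimes>\<^sub>t q) (\<delta> b) = tensor_map (\<lambda>z. z) (\<lambda>z. q * z) (T2 \<delta> (p \<otimes>\<^sub>t b))"
  by (rule tensor_eqI(2)[OF nd2])
    (simp add: tensor_map_mult_simps times_T2 times_tensor_pure flip: mright_mult_left[OF nd2])

text \<open>Both sides are (c \<otimes> I)\<delta>(p)(I \<otimes> q). Testing with pure tensors on
  both sides allows \<delta>(p) to act to the left in one expression and to the right in the
  other.\<close>

lemma T1_T2: "tensor_map (\<lambda>z. z) (\<lambda>z. z * q) (T2 \<delta> (c \<otimes>\<^sub>t p)) = tensor_map (\<lambda>z. c * z) (\<lambda>z. z) (T1 \<delta> (p \<otimes>\<^sub>t q))"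
  by (rule tensor_eqI(1)[OF nd2], rule tensor_eqI(2)[OF nd2])
    (simp add: tensor_map_mult_simps mult.assoc[symmetric] times_T2 mright_mult,
     simp add: tensor_map_mult_simps mult.assoc T1_times)

lemma T1_mult_left: "T1 \<delta> ((a * b) \<otimes>\<^sub>t c) = mleft (\<delta> a) (T1 \<delta> (b \<otimes>\<^sub>t c))"
  by (rule tensor_eqI(1)[OF nd2]) (simp add: T1_times \<delta>_mult flip: mleft_mult[OF nd2])

text \<open>The commutation axiom at \<open>c \<otimes> u\<close>, in a form without an auxiliary element for the rebracketing.\<close>

lemma T1_T2_commute:
  "tensor_map (\<lambda>z. z) (T1 \<delta>) (tensor_assoc (tensor_map (\<lambda>p. T2 \<delta> (c \<otimes>\<^sub>t p)) (\<lambda>z. z) u))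
    = tensor_assoc (tensor_map (\<lambda>p. T2 \<delta> (c \<otimes>\<^sub>t p)) (\<lambda>z. z) (T1 \<delta> u))"
proof -
  \<comment> \<open>\<open>x u\<close> is c \<otimes> u bracketed to the left, as the axiom expects;
    \<open>x (T1 \<delta> u)\<close> is then the auxiliary element \<open>y\<close> of the
    axiom.\<close>
  define x where "x u = tensor_map (\<lambda>p. c \<otimes>\<^sub>t p) (\<lambda>z. z) u" for u :: "('a, 'a) tensor"
  have assoc: "tensor_assoc (x u) = c \<otimes>\<^sub>t u" for u
    by (induction u rule: tensor_induct) (simp_all add: x_def linear_simps pure_tensor_add_right)
  have T2: "tensor_map (T2 \<delta>) id (x u) = tensor_map (\<lambda>p. T2 \<delta> (c \<otimes>\<^sub>t p)) (\<lambda>z. z) u" for u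
    unfolding x_def id_def
    by (rule tensor_map_compose) (simp_all add: clinear_T2 linear_simps)
  have "tensor_assoc (x (T1 \<delta> u)) = tensor_map id (T1 \<delta>) (tensor_assoc (x u))"
    by (simp add: assoc clinear_T1 linear_simps)
  with mha have "tensor_map id (T1 \<delta>) (tensor_assoc (tensor_map (T2 \<delta>) id (x u)))
      = tensor_assoc (tensor_map (T2 \<delta>) id (x (T1 \<delta> u)))"
    unfolding multiplier_hopf_algebra_def by blast
  then show ?thesis unfolding T2 by (simp add: id_def)
qed

section \<open>The counit and non degeneracy of the comultiplication\<close>

text \<open>Apply \<open>id \<otimes> (\<mu> \<circ> T\<^sub>1\<^sup>-\<^sup>1)\<close> to the commutation axiom at \<open>c \<otimes> T\<^sub>1\<^sup>-\<^sup>1(a \<otimes> b)\<close>. Since \<open>T\<^sub>2\<close> is onto, it follows that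
  \<open>p \<otimes> \<mu>(T\<^sub>1\<^sup>-\<^sup>1(q \<otimes> b)) = \<mu>(T\<^sub>2\<^sup>-\<^sup>1(p \<otimes> q)) \<otimes> b\<close>, so \<open>b \<mapsto> \<mu>(T\<^sub>1\<^sup>-\<^sup>1(q \<otimes> b))\<close> is a multiple of the identity.\<close>

lemma counit_left_aux:
  "tensor_map (\<lambda>z. z) (\<lambda>q. mult_map (T1i (q \<otimes>\<^sub>t b))) (T2 \<delta> (c \<otimes>\<^sub>t a)) = (c * a) \<otimes>\<^sub>t b"
proof -
  let ?D = "\<lambda>u. tensor_assoc (tensor_map (\<lambda>p. T2 \<delta> (c \<otimes>\<^sub>t p)) (\<lambda>z. z) u)"
  have lin_T2: "clinear (\<lambda>p. T2 \<delta> (c \<otimes>\<^sub>t p))"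
    by (rule clinear_compose[OF clinear_T2 clinear_pure_tensor_right])
  have lin_E: "clinear (\<lambda>w. mult_map (T1i w))"
    by (rule clinear_compose[OF clinear_mult_map clinear_Ti(1)])
  have lin_E': "clinear (\<lambda>q. mult_map (T1i (q \<otimes>\<^sub>t b)))" for b
    by (rule clinear_compose[OF lin_E clinear_pure_tensor_left])
  have 1: "tensor_map (\<lambda>z. z) mult_map (tensor_assoc (v \<otimes>\<^sub>t q)) = tensor_map (\<lambda>z. z) (\<lambda>z. z * q) v"
    for v and q :: 'a
    by (induction v rule: tensor_induct) (simp_all add: linear_simps clinear_mult_map pure_tensor_add_left)
  \<comment> \<open>Multiplying the last two legs turns T2(c \<otimes> p) \<otimes> q into (c
    \<otimes> I)T1(p \<otimes> q) by \<open>T1_T2\<close>; so \<open>T2\<close> disappears and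
    \<open>T1 \<delta> u\<close> can be evaluated.\<close>
  have 2: "tensor_map (\<lambda>z. z) mult_map (?D u) = tensor_map (\<lambda>z. c * z) (\<lambda>z. z) (T1 \<delta> u)" for u
    by (induction u rule: tensor_induct)
      (simp_all add: linear_simps clinear_mult_map lin_T2 T_linear 1 T1_T2)
  have 3: "tensor_map (\<lambda>z. z) (\<lambda>w. mult_map (T1i w)) (tensor_assoc (v \<otimes>\<^sub>t b))
      = tensor_map (\<lambda>z. z) (\<lambda>q. mult_map (T1i (q \<otimes>\<^sub>t b))) v" for v and b :: 'a
    by (induction v rule: tensor_induct) (simp_all add: linear_simps lin_E lin_E' pure_tensor_add_left)
  define u where "u = T1i (a \<otimes>\<^sub>t b)"
  have u: "T1 \<delta> u = a \<otimes>\<^sub>t b" by (simp add: u_def)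
  have "tensor_map (\<lambda>z. z) (\<lambda>w. mult_map (T1i w)) (tensor_map (\<lambda>z. z) (T1 \<delta>) (?D u))
      = tensor_map (\<lambda>z. z) (\<lambda>x. mult_map (T1i (T1 \<delta> x))) (?D u)"
    by (rule tensor_map_compose[OF _ lin_E _ clinear_T1]) (rule clinear_id)+
  also have "\<dots> = (c * a) \<otimes>\<^sub>t b" by (simp add: 2 u linear_simps)
  finally have "tensor_map (\<lambda>z. z) (\<lambda>w. mult_map (T1i w)) (?D (T1 \<delta> u)) = (c * a) \<otimes>\<^sub>t b"
    by (simp only: T1_T2_commute)
  then show ?thesis by (simp add: u 3 lin_T2 linear_simps)
qed

lemma ex_counit: "\<exists>\<epsilon>. \<forall>a b. mult_map (T1i (a \<otimes>\<^sub>t b)) = \<epsilon> a *\<^sub>C b"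
proof -
  have "\<exists>e. \<forall>b. mult_map (T1i (q \<otimes>\<^sub>t b)) = e *\<^sub>C b" for q
  proof -
    obtain p :: 'a where "p \<noteq> 0" using nontrivial by blast
    then obtain \<omega> :: "'a \<Rightarrow> complex" where \<omega>: "clinear \<omega>" "\<omega> p = 1" by (rule ex_functional)
    have lin: "clinear (\<lambda>q. mult_map (T1i (q \<otimes>\<^sub>t b)))" for b
      by (intro clinear_compose[OF clinear_mult_map] clinear_compose[OF clinear_Ti(1)] clinear_pure_tensor_left)
    have "tensor_map (\<lambda>z. z) (\<lambda>q. mult_map (T1i (q \<otimes>\<^sub>t b))) (T2 \<delta> u) = mult_map u \<otimes>\<^sub>t b" for u and b :: 'a
      by (induction u rule: tensor_induct)
        (simp_all add: linear_simps T_linear lin counit_left_aux pure_tensor_add_left)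
    from this[of _ "T2i (p \<otimes>\<^sub>t q)"]
    have "p \<otimes>\<^sub>t mult_map (T1i (q \<otimes>\<^sub>t b)) = mult_map (T2i (p \<otimes>\<^sub>t q)) \<otimes>\<^sub>t b" for b
      by (simp add: lin linear_simps)
    \<comment> \<open>As \<omega>(p) = 1, slicing isolates the scalar, which is the same for every
      b.\<close>
    from arg_cong[OF this, of "slice_left \<omega>"]
    have "mult_map (T1i (q \<otimes>\<^sub>t b)) = \<omega> (mult_map (T2i (p \<otimes>\<^sub>t q))) *\<^sub>C b" for b
      by (simp add: \<omega> scaleC_one)
    then show ?thesis by blast
  qed
  then show ?thesis by metis
qed

lemma scaleC_cancel: "(\<And>b::'a. c *\<^sub>C b = d *\<^sub>C b) \<Longrightarrow> c = d"
  using nontrivial by (metis complex_vector.scale_cancel_right)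

text \<open>The description defining \<open>counit\<close> has a unique solution, namely the scalar
  of \<open>ex_counit\<close>. The identity for \<open>T1\<close> holds by construction, the one for
  \<open>T2\<close> comes from \<open>counit_left_aux\<close>, and surjectivity of \<open>T1\<close>
  gives uniqueness.\<close>

lemma counit_characterization:
  "alg_hom (counit \<delta>) \<and> (\<forall>a b. slice_right (counit \<delta>) (T2 \<delta> (a \<otimes>\<^sub>t b)) = a * b) \<and>
     (\<forall>a b. slice_left (counit \<delta>) (T1 \<delta> (a \<otimes>\<^sub>t b)) = a * b)"
proof -
  obtain \<epsilon> where \<epsilon>: "mult_map (T1i (a \<otimes>\<^sub>t b)) = \<epsilon> a *\<^sub>C b" for a b using ex_counit by blast
  have lin: "clinear \<epsilon>"
  proof (rule clinearI; rule scaleC_cancel)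
    fix a a' b :: 'a and c
    show "\<epsilon> (a + a') *\<^sub>C b = (\<epsilon> a + \<epsilon> a') *\<^sub>C b"
      by (simp add: pure_tensor_add_left T_linear mult_map_linear scaleC_add_left flip: \<epsilon>)
    have "\<epsilon> (c *\<^sub>C a) *\<^sub>C b = c *\<^sub>C \<epsilon> a *\<^sub>C b"
      by (simp add: pure_tensor_scale_left T_linear mult_map_linear flip: \<epsilon>)
    then show "\<epsilon> (c *\<^sub>C a) *\<^sub>C b = (c *\<^sub>C \<epsilon> a) *\<^sub>C b" by (simp add: scaleC_scaleC scaleC_complex_def)
  qed
  have "slice_left \<epsilon> w = mult_map (T1i w)" for w
    by (induction w rule: tensor_induct) (simp_all add: linear_simps T_linear lin \<epsilon>)
  then have left: "slice_left \<epsilon> (T1 \<delta> u) = mult_map u" for u by simp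
  have right: "slice_right \<epsilon> (T2 \<delta> (c \<otimes>\<^sub>t a)) = c * a" for c a
  proof -
    obtain b :: 'a where b: "b \<noteq> 0" using nontrivial by blast
    have lin': "clinear (\<lambda>q. \<epsilon> q *\<^sub>C b)"
      by (rule clinearI) (simp_all add: clinearD[OF lin] scaleC_add_left scaleC_scaleC scaleC_complex_def)
    have "tensor_map (\<lambda>z. z) (\<lambda>q. \<epsilon> q *\<^sub>C b) v = slice_right \<epsilon> v \<otimes>\<^sub>t b" for v :: "('a, 'a) tensor"
      by (induction v rule: tensor_induct)
        (simp_all add: linear_simps lin lin' pure_tensor_add_left pure_tensor_scale_left pure_tensor_scale_right)
    with counit_left_aux[of b c a] have "slice_right \<epsilon> (T2 \<delta> (c \<otimes>\<^sub>t a)) \<otimes>\<^sub>t b = (c * a) \<otimes>\<^sub>t b"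
      by (simp add: \<epsilon>)
    then show ?thesis using b by (rule pure_tensor_cancel_right)
  qed
  \<comment> \<open>Since \<delta>(a) times T1(b \<otimes> c) is T1(ab \<otimes> c), this reduces to
    associativity of the product.\<close>
  have comult: "slice_left \<epsilon> (mleft (\<delta> a) (T1 \<delta> u)) = a * slice_left \<epsilon> (T1 \<delta> u)" for a u
    by (induction u rule: tensor_induct)
      (simp_all add: linear_simps T_linear lin left mult.assoc flip: T1_mult_left)
  \<comment> \<open>At p \<otimes> q the previous fact reads (\<epsilon> \<otimes> id)(T1(a
    \<otimes> q)(p \<otimes> I)) = \<epsilon>(p)aq. As \<open>T1\<close> is onto, multiplying the
    first leg by p multiplies the slice by \<epsilon>(p), whence \<epsilon> is
    multiplicative.\<close>
  have mult_T1: "slice_left \<epsilon> (tensor_map (\<lambda>z. z * p) (\<lambda>z. z) (T1 \<delta> u)) = \<epsilon> p *\<^sub>C slice_left \<epsilon> (T1 \<delta> u)" for p u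
  proof (induction u rule: tensor_induct)
    case (pure a q)
    show ?case using comult[of a "T1i (p \<otimes>\<^sub>t q)"] by (simp add: lin comult_left left scaleC_mult_right)
  qed (simp_all add: linear_simps T_linear lin)
  have mult_aux: "slice_left \<epsilon> (tensor_map (\<lambda>z. z * p) (\<lambda>z. z) w) = \<epsilon> p *\<^sub>C slice_left \<epsilon> w"
    for p and w :: "('a, 'a) tensor"
    using mult_T1[of p "T1i w"] by simp
  have mult: "\<epsilon> (r * p) = \<epsilon> r * \<epsilon> p" for r p
    using mult_aux[of p "r \<otimes>\<^sub>t _"]
    by (intro scaleC_cancel) (simp add: linear_simps lin scaleC_scaleC mult.commute)
  show ?thesis
    unfolding counit_def
  proof (rule theI[where a = \<epsilon>])
    show "alg_hom \<epsilon> \<and> (\<forall>a b. slice_right \<epsilon> (T2 \<delta> (a \<otimes>\<^sub>t b)) = a * b) \<and>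
      (\<forall>a b. slice_left \<epsilon> (T1 \<delta> (a \<otimes>\<^sub>t b)) = a * b)"
      by (simp add: alg_hom_def lin mult left right)
    fix \<epsilon>' assume \<epsilon>': "alg_hom \<epsilon>' \<and> (\<forall>a b. slice_right \<epsilon>' (T2 \<delta> (a \<otimes>\<^sub>t b)) = a * b) \<and>
      (\<forall>a b. slice_left \<epsilon>' (T1 \<delta> (a \<otimes>\<^sub>t b)) = a * b)"
    then have lin': "clinear \<epsilon>'" by (simp add: alg_hom_def)
    have "slice_left \<epsilon>' (T1 \<delta> u) = mult_map u" for u
      by (induction u rule: tensor_induct) (simp_all add: linear_simps T_linear lin' \<epsilon>')
    from this[of "T1i _"] have "slice_left \<epsilon>' w = mult_map (T1i w)" for w by simp
    from this[of "_ \<otimes>\<^sub>t _"] have "\<epsilon>' a *\<^sub>C b = \<epsilon> a *\<^sub>C b" for a and b :: 'a by (simp add: lin' \<epsilon>)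
    then show "\<epsilon>' = \<epsilon>" by (intro ext scaleC_cancel)
  qed
qed

abbreviation "\<epsilon> \<equiv> counit \<delta>"

lemma counit_hom: "alg_hom \<epsilon>" and counit_linear: "clinear \<epsilon>" and counit_mult: "\<epsilon> (a * b) = \<epsilon> a * \<epsilon> b"
  using counit_characterization by (auto simp: alg_hom_def)

lemma counit_T1: "slice_left \<epsilon> (T1 \<delta> u) = mult_map u"
  by (induction u rule: tensor_induct)
    (simp_all add: linear_simps T_linear counit_linear counit_characterization)

lemma counit_T2: "slice_right \<epsilon> (T2 \<delta> u) = mult_map u"
  by (induction u rule: tensor_induct)
    (simp_all add: linear_simps T_linear counit_linear counit_characterization)

text \<open>Otherwise \<mu> = (\<epsilon> \<otimes> id) \<circ> T1 would vanish, against non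
  degeneracy.\<close>

lemma counit_nonzero: "\<exists>e. \<epsilon> e = 1"
proof -
  have "\<exists>e. \<epsilon> e \<noteq> 0"
  proof (rule ccontr)
    assume "\<nexists>e. \<epsilon> e \<noteq> 0"
    then have 0: "\<epsilon> e = 0" for e by blast
    have "slice_left \<epsilon> (a \<otimes>\<^sub>t b) = 0" for a b :: 'a
      unfolding slice_left_pure[OF counit_linear] 0 by simp
    then have "slice_left \<epsilon> w = 0" for w :: "('a, 'a) tensor"
      by (induction w rule: tensor_induct) (simp_all add: slice_left_linear[OF counit_linear])
    then have "a * b = 0" for a b :: 'a using counit_T1[of "a \<otimes>\<^sub>t b"] by simp
    with nontrivial nondegenerate_productD(1)[OF nd] show False by blast
  qed
  then obtain e where "\<epsilon> e \<noteq> 0" by blast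
  then have "\<epsilon> ((1 / \<epsilon> e) *\<^sub>C e) = 1" by (simp add: clinearD[OF counit_linear] scaleC_complex_def)
  then show ?thesis by blast
qed

lemma slice_left_counit_surj: "\<exists>w. slice_left \<epsilon> w = a"
  using counit_nonzero by (metis slice_left_pure counit_linear scaleC_one)

lemma slice_right_counit_surj: "\<exists>w. slice_right \<epsilon> w = a"
  using counit_nonzero by (metis slice_right_pure counit_linear scaleC_one)

text \<open>Products span the algebra, because \<mu> = (\<epsilon> \<otimes> id) \<circ> T1 is a
  composition of surjections.\<close>

lemma mult_map_surj: "\<exists>u. mult_map u = (a::'a)"
  using slice_left_counit_surj counit_T1[of "T1i _"] by (metis T_inv(1))

text \<open>The span of \<delta>(A)(A \<otimes> A) contains T1(u)(y \<otimes> I) for all u, hence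
  every xy \<otimes> q since \<open>T1\<close> is onto, and products span A. The other side uses
  \<open>T2\<close> in the same way.\<close>

lemma nondegenerate_comult: "nondegenerate_hom \<delta>"
proof -
  let ?L = "{mleft (\<delta> b) t |b t. True}" and ?R = "{mright t (\<delta> b) |b t. True}"
  have L: "tensor_map (\<lambda>z. z * y) (\<lambda>z. z) (T1 \<delta> u) \<in> complex_vector.span ?L" for y u
  proof (induction u rule: tensor_induct)
    case (pure a b)
    show ?case by (rule complex_vector.span_base) (auto simp flip: comult_left)
  qed (simp_all add: linear_simps T_linear complex_vector.span_add complex_vector.span_zero)
  have "mult_map u \<otimes>\<^sub>t q \<in> complex_vector.span ?L" for u q
  proof (induction u rule: tensor_induct)
    case (pure x y)
    show ?case using L[of y "T1i (x \<otimes>\<^sub>t q)"] by (simp add: linear_simps)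
  qed (simp_all add: linear_simps pure_tensor_add_left complex_vector.span_add complex_vector.span_zero)
  then have "p \<otimes>\<^sub>t q \<in> complex_vector.span ?L" for p q using mult_map_surj[of p] by blast
  then have "t \<in> complex_vector.span ?L" for t
    by (induction t rule: tensor_induct) (auto simp: complex_vector.span_add complex_vector.span_zero)
  moreover have R: "tensor_map (\<lambda>z. z) (\<lambda>z. x * z) (T2 \<delta> u) \<in> complex_vector.span ?R" for x u
  proof (induction u rule: tensor_induct)
    case (pure a b)
    show ?case by (rule complex_vector.span_base) (auto simp flip: comult_right)
  qed (simp_all add: linear_simps T_linear complex_vector.span_add complex_vector.span_zero)
  have "p \<otimes>\<^sub>t mult_map u \<in> complex_vector.span ?R" for p u
  proof (induction u rule: tensor_induct)
    case (pure x y)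
    show ?case using R[of x "T2i (p \<otimes>\<^sub>t y)"] by (simp add: linear_simps)
  qed (simp_all add: linear_simps pure_tensor_add_right complex_vector.span_add complex_vector.span_zero)
  then have "p \<otimes>\<^sub>t q \<in> complex_vector.span ?R" for p q using mult_map_surj[of q] by blast
  then have "t \<in> complex_vector.span ?R" for t
    by (induction t rule: tensor_induct) (auto simp: complex_vector.span_add complex_vector.span_zero)
  ultimately show ?thesis
    unfolding nondegenerate_hom_def alg_hom_def by (auto simp: \<delta>_linear \<delta>_mult)
qed

section \<open>The coinverse\<close>

text \<open>This time \<open>id \<otimes> ((\<epsilon> \<otimes> id) \<circ> T\<^sub>1\<^sup>-\<^sup>1)\<close>, followed by \<open>\<mu>\<close>, is applied to the commutation axiom.\<close>

lemma coinverse_left_aux: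
  "mult_map (tensor_map (\<lambda>z. z) (\<lambda>q. slice_left \<epsilon> (T1i (q \<otimes>\<^sub>t b))) (T2 \<delta> (c \<otimes>\<^sub>t a))) = \<epsilon> a *\<^sub>C (c * b)"
proof -
  let ?D = "\<lambda>u. tensor_assoc (tensor_map (\<lambda>p. T2 \<delta> (c \<otimes>\<^sub>t p)) (\<lambda>z. z) u)"
  have lin_T2: "clinear (\<lambda>p. T2 \<delta> (c \<otimes>\<^sub>t p))"
    by (rule clinear_compose[OF clinear_T2 clinear_pure_tensor_right])
  have lin_E: "clinear (\<lambda>w. slice_left \<epsilon> (T1i w))"
    by (rule clinear_compose[OF clinear_slice_left[OF counit_linear] clinear_Ti(1)])
  have lin_E': "clinear (\<lambda>q. slice_left \<epsilon> (T1i (q \<otimes>\<^sub>t b)))" for b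
    by (rule clinear_compose[OF lin_E clinear_pure_tensor_left])
  have 1: "tensor_map (\<lambda>z. z) (slice_left \<epsilon>) (tensor_assoc (v \<otimes>\<^sub>t q)) = slice_right \<epsilon> v \<otimes>\<^sub>t q"
    for v and q :: 'a
    by (induction v rule: tensor_induct)
      (simp_all add: linear_simps clinear_slice_left counit_linear pure_tensor_add_left
        pure_tensor_scale_left pure_tensor_scale_right)
  have 2: "tensor_map (\<lambda>z. z) (slice_left \<epsilon>) (?D u) = tensor_map (\<lambda>z. c * z) (\<lambda>z. z) u"
    for u :: "('a, 'a) tensor"
    by (induction u rule: tensor_induct)
      (simp_all add: linear_simps clinear_slice_left counit_linear lin_T2 T_linear 1 counit_T2)
  have 3: "tensor_map (\<lambda>z. z) (\<lambda>w. slice_left \<epsilon> (T1i w)) (tensor_assoc (v \<otimes>\<^sub>t b))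
      = tensor_map (\<lambda>z. z) (\<lambda>q. slice_left \<epsilon> (T1i (q \<otimes>\<^sub>t b))) v" for v and b :: 'a
    by (induction v rule: tensor_induct) (simp_all add: linear_simps lin_E lin_E' pure_tensor_add_left)
  define u where "u = T1i (a \<otimes>\<^sub>t b)"
  have u: "T1 \<delta> u = a \<otimes>\<^sub>t b" by (simp add: u_def)
  have "tensor_map (\<lambda>z. z) (\<lambda>w. slice_left \<epsilon> (T1i w)) (tensor_map (\<lambda>z. z) (T1 \<delta>) (?D u))
      = tensor_map (\<lambda>z. z) (\<lambda>x. slice_left \<epsilon> (T1i (T1 \<delta> x))) (?D u)"
    by (rule tensor_map_compose[OF _ lin_E _ clinear_T1]) (rule clinear_id)+
  also have "\<dots> = tensor_map (\<lambda>z. c * z) (\<lambda>z. z) u" by (simp add: 2)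
  finally have "tensor_map (\<lambda>z. z) (\<lambda>w. slice_left \<epsilon> (T1i w)) (?D (T1 \<delta> u)) = tensor_map (\<lambda>z. c * z) (\<lambda>z. z) u"
    by (simp only: T1_T2_commute)
  then have "tensor_map (\<lambda>z. z) (\<lambda>q. slice_left \<epsilon> (T1i (q \<otimes>\<^sub>t b))) (T2 \<delta> (c \<otimes>\<^sub>t a)) = tensor_map (\<lambda>z. c * z) (\<lambda>z. z) u"
    by (simp add: u 3 lin_T2 linear_simps)
  moreover have "mult_map (tensor_map (\<lambda>z. c * z) (\<lambda>z. z) v) = c * mult_map v" for v
    by (induction v rule: tensor_induct) (simp_all add: linear_simps mult.assoc)
  moreover have "mult_map u = \<epsilon> a *\<^sub>C b"
    using counit_T1[of u] by (simp add: u counit_linear)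
  ultimately show ?thesis by (simp add: scaleC_mult_right)
qed

text \<open>These are the future maps c \<mapsto> \<kappa>(a)c, a \<mapsto> \<kappa>(a)c and b
  \<mapsto> b\<kappa>(a).\<close>

lemma clinear_coinverse_actions:
  "clinear (\<lambda>c. slice_left \<epsilon> (T1i (a \<otimes>\<^sub>t c)))" "clinear (\<lambda>a. slice_left \<epsilon> (T1i (a \<otimes>\<^sub>t c)))"
  "clinear (\<lambda>b. slice_right \<epsilon> (T2i (b \<otimes>\<^sub>t a)))"
  by (intro clinear_compose[OF clinear_slice_left[OF counit_linear]]
      clinear_compose[OF clinear_slice_right[OF counit_linear]] clinear_compose[OF clinear_Ti(1)]
      clinear_compose[OF clinear_Ti(2)] clinear_pure_tensor_left clinear_pure_tensor_right)+

text \<open>The condition (b\<kappa>(a))c = b(\<kappa>(a)c) that makes \<kappa>(a) a multiplier. It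
  is \<open>coinverse_left_aux\<close>, extended linearly from c \<otimes> a to any u and evaluated
  at T2i(b \<otimes> a).\<close>

lemma coinverse_actions_compatible:
  "slice_right \<epsilon> (T2i (b \<otimes>\<^sub>t a)) * c = b * slice_left \<epsilon> (T1i (a \<otimes>\<^sub>t c))"
proof -
  have "mult_map (tensor_map (\<lambda>z. z) (\<lambda>q. slice_left \<epsilon> (T1i (q \<otimes>\<^sub>t c))) (T2 \<delta> u)) = slice_right \<epsilon> u * c" for u
    by (induction u rule: tensor_induct)
      (simp_all add: linear_simps T_linear counit_linear clinear_coinverse_actions coinverse_left_aux scaleC_mult_left)
  from this[of "T2i (b \<otimes>\<^sub>t a)"] show ?thesis by (simp add: linear_simps clinear_coinverse_actions)
qed

lemma coinverse_characterization:
  "alg_antihom (coinverse \<delta>) \<and>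
     (\<forall>p q. mleft (coinverse \<delta> p) q = slice_left \<epsilon> (T1i (p \<otimes>\<^sub>t q))) \<and>
     (\<forall>p q. mright q (coinverse \<delta> p) = slice_right \<epsilon> (T2i (q \<otimes>\<^sub>t p)))"
proof -
  define \<kappa> where "\<kappa> a = mk_multiplier (\<lambda>c. slice_left \<epsilon> (T1i (a \<otimes>\<^sub>t c))) (\<lambda>b. slice_right \<epsilon> (T2i (b \<otimes>\<^sub>t a)))" for a
  have \<kappa>: "mleft (\<kappa> a) c = slice_left \<epsilon> (T1i (a \<otimes>\<^sub>t c))" "mright b (\<kappa> a) = slice_right \<epsilon> (T2i (b \<otimes>\<^sub>t a))" for a b c
    unfolding \<kappa>_def
    by (rule mk_multiplier[OF clinear_coinverse_actions(1,3) coinverse_actions_compatible])+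
  have lin: "clinear \<kappa>"
    by (intro clinearI multiplier_eqI_left[OF nd])
      (simp_all add: \<kappa> pure_tensor_add_left pure_tensor_scale_left T_linear linear_simps counit_linear)
  have lin_q: "clinear (\<lambda>q. mleft (\<kappa> q) c)" for c
    by (rule clinear_compose[OF clinear_mleft_arg lin])
  \<comment> \<open>On pure tensors s(p \<otimes> q) = \<kappa>(p)q, while s \<circ> T1 = \<epsilon>
    \<otimes> id; comparing the two descriptions yields the properties of \<kappa>.\<close>
  define s where "s w = slice_left \<epsilon> (T1i w)" for w
  have s_linear: "s (x + y) = s x + s y" "s 0 = 0" for x y
    by (simp_all add: s_def linear_simps T_linear counit_linear)
  have s_comult: "s (mleft (\<delta> a) (T1 \<delta> u)) = \<epsilon> a *\<^sub>C s (T1 \<delta> u)" for a u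
    by (induction u rule: tensor_induct)
      (simp_all add: s_def linear_simps T_linear counit_linear counit_mult scaleC_scaleC flip: T1_mult_left)
  \<comment> \<open>Parallel to multiplicativity of the counit: \<delta>(a)(p \<otimes> q) = T1(a
    \<otimes> q)(p \<otimes> I) gives s(w(p \<otimes> I)) = \<kappa>(p)s(w) for w = T1(a \<otimes>
    q), hence for all w. At w = r \<otimes> q this is \<kappa>(rp)q =
    \<kappa>(p)\<kappa>(r)q.\<close>
  have "s (tensor_map (\<lambda>z. z * p) (\<lambda>z. z) (T1 \<delta> u)) = mleft (\<kappa> p) (s (T1 \<delta> u))" for p u
  proof (induction u rule: tensor_induct)
    case (pure a q)
    have "s (tensor_map (\<lambda>z. z * p) (\<lambda>z. z) (T1 \<delta> (a \<otimes>\<^sub>t q))) = \<epsilon> a *\<^sub>C s (p \<otimes>\<^sub>t q)"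
      using s_comult[of a "T1i (p \<otimes>\<^sub>t q)"] by (simp add: comult_left)
    then show ?case by (simp add: \<kappa> s_def counit_linear)
  qed (simp_all add: linear_simps T_linear s_linear)
  from this[of _ "T1i (_ \<otimes>\<^sub>t _)"] have antimult: "mleft (\<kappa> (r * p)) q = mleft (\<kappa> p) (mleft (\<kappa> r) q)" for p q r
    by (simp add: linear_simps \<kappa> s_def)
  have anti: "alg_antihom \<kappa>"
    unfolding alg_antihom_def using lin by (auto intro!: multiplier_eqI_left[OF nd] simp: antimult)
  have right: "mult_map (tensor_map (\<lambda>p. mright a (\<kappa> p)) (\<lambda>z. z) w) = a * s w" for a w
  proof -
    have lin': "clinear (\<lambda>p. mright a (\<kappa> p))" by (rule clinear_compose[OF clinear_mright_arg lin])
    show ?thesis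
    proof (induction w rule: tensor_induct)
      case (pure p q)
      show ?case by (simp add: lin' linear_simps mright_mult) (simp add: \<kappa> s_def)
    qed (simp_all add: linear_simps lin' s_linear)
  qed
  have "coinverse \<delta> = \<kappa>"
    unfolding coinverse_def
  proof (rule the_equality)
    show "alg_antihom \<kappa> \<and>
     (\<forall>a b c. mult_map (tensor_map id (\<lambda>q. mleft (\<kappa> q) c) (T2 \<delta> (a \<otimes>\<^sub>t b))) = \<epsilon> b *\<^sub>C (a * c)) \<and>
     (\<forall>a b c. mult_map (tensor_map (\<lambda>p. mright a (\<kappa> p)) id (T1 \<delta> (b \<otimes>\<^sub>t c))) = \<epsilon> b *\<^sub>C (a * c))"
      using coinverse_left_aux
      by (simp add: anti id_def right s_def counit_linear scaleC_mult_right) (simp add: \<kappa>)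
    fix \<kappa>' assume \<kappa>': "alg_antihom \<kappa>' \<and>
     (\<forall>a b c. mult_map (tensor_map id (\<lambda>q. mleft (\<kappa>' q) c) (T2 \<delta> (a \<otimes>\<^sub>t b))) = \<epsilon> b *\<^sub>C (a * c)) \<and>
     (\<forall>a b c. mult_map (tensor_map (\<lambda>p. mright a (\<kappa>' p)) id (T1 \<delta> (b \<otimes>\<^sub>t c))) = \<epsilon> b *\<^sub>C (a * c))"
    have lin': "clinear (\<lambda>p. mright a (\<kappa>' p))" for a
      using \<kappa>' by (intro clinear_compose[OF clinear_mright_arg]) (simp add: alg_antihom_def)
    \<comment> \<open>Uniqueness: the identity for \<open>T1\<close>, taken at T1i(p \<otimes> q),
      prescribes a\<kappa>'(p)q.\<close>
    have "mult_map (tensor_map (\<lambda>p. mright a (\<kappa>' p)) (\<lambda>z. z) (T1 \<delta> u)) = a * slice_left \<epsilon> u" for a u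
      by (induction u rule: tensor_induct)
        (use \<kappa>' in \<open>simp_all add: id_def linear_simps T_linear lin' counit_linear scaleC_mult_right\<close>)
    from this[of _ "T1i (_ \<otimes>\<^sub>t _)"] have *: "a * mleft (\<kappa>' p) q = a * mleft (\<kappa> p) q" for a p q
      by (simp add: lin' linear_simps mright_mult \<kappa>)
    have "mleft (\<kappa>' p) q = mleft (\<kappa> p) q" for p q
    proof -
      have "a * (mleft (\<kappa>' p) q - mleft (\<kappa> p) q) = 0" for a by (simp add: right_diff_distrib *)
      then show ?thesis using nondegenerate_productD(2)[OF nd] by (metis eq_iff_diff_eq_0)
    qed
    then show "\<kappa>' = \<kappa>" by (intro ext multiplier_eqI_left[OF nd])
  qed
  then show ?thesis by (simp add: anti \<kappa>)
qed

text \<open>The span of \<kappa>(A)A contains (\<epsilon> \<otimes> id)(T1i(A \<otimes> A)) =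
  (\<epsilon> \<otimes> id)(A \<otimes> A) = A, and symmetrically with \<open>T2i\<close> on the
  other side.\<close>

lemma coinverse_nondegenerate: "nondegenerate_map (coinverse \<delta>)"
proof -
  let ?L = "{mleft (coinverse \<delta> b) a |b a. True}" and ?R = "{mright a (coinverse \<delta> b) |b a. True}"
  have L: "slice_left \<epsilon> (T1i w) \<in> complex_vector.span ?L" for w
  proof (induction w rule: tensor_induct)
    case (pure a b)
    have "slice_left \<epsilon> (T1i (a \<otimes>\<^sub>t b)) \<in> ?L"
      using coinverse_characterization by (metis (mono_tags, lifting) mem_Collect_eq)
    then show ?case by (rule complex_vector.span_base)
  qed (simp_all add: linear_simps T_linear counit_linear complex_vector.span_add complex_vector.span_zero)
  have R: "slice_right \<epsilon> (T2i w) \<in> complex_vector.span ?R" for w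
  proof (induction w rule: tensor_induct)
    case (pure a b)
    have "slice_right \<epsilon> (T2i (a \<otimes>\<^sub>t b)) \<in> ?R"
      using coinverse_characterization by (metis (mono_tags, lifting) mem_Collect_eq)
    then show ?case by (rule complex_vector.span_base)
  qed (simp_all add: linear_simps T_linear counit_linear complex_vector.span_add complex_vector.span_zero)
  have "a \<in> complex_vector.span ?L" for a
    using slice_left_counit_surj[of a] L[of "T1 \<delta> _"] by auto
  moreover have "a \<in> complex_vector.span ?R" for a
    using slice_right_counit_surj[of a] R[of "T2 \<delta> _"] by auto
  ultimately show ?thesis
    using coinverse_characterization unfolding nondegenerate_map_def alg_antihom_def by blast
qed


section \<open>Extending counit and coinverse\<close>

lemma extend_comult: "alg_hom (extend_hom \<delta>) \<and> extend_hom \<delta> 1 = 1 \<and> (\<forall>b. extend_hom \<delta> (embed b) = \<delta> b)"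
  by (rule extend_hom_works[OF nd2 nd nondegenerate_comult])

lemma extend_counit: "alg_hom (extend_hom \<epsilon>) \<and> extend_hom \<epsilon> 1 = 1 \<and> (\<forall>b. extend_hom \<epsilon> (embed b) = \<epsilon> b)"
  using counit_nonzero extend_character_works[OF nd counit_hom] by (metis zero_neq_one)

lemma extend_coinverse: "alg_antihom (extend_antihom (coinverse \<delta>)) \<and> extend_antihom (coinverse \<delta>) 1 = 1 \<and>
  (\<forall>b. extend_antihom (coinverse \<delta>) (embed b) = coinverse \<delta> b)"
  using coinverse_characterization by (intro extend_antihom_works[OF nd nd _ coinverse_nondegenerate]) blast

text \<open>The analogue of \<open>T1_mult_left\<close> for a multiplier x, from
  \<delta>(x)\<delta>(a) = \<delta>(xa).\<close>

lemma extend_comult_T1: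
  "mleft (extend_hom \<delta> x) (T1 \<delta> (a \<otimes>\<^sub>t b)) = T1 \<delta> (mleft x a \<otimes>\<^sub>t b)"
proof -
  have "extend_hom \<delta> x * \<delta> a = extend_hom \<delta> (x * embed a)"
    using extend_comult by (simp add: alg_hom_def)
  also have "\<dots> = \<delta> (mleft x a)" using extend_comult by (simp add: mult_embed[OF nd])
  finally have *: "mleft (extend_hom \<delta> x) (mleft (\<delta> a) s) = mleft (\<delta> (mleft x a)) s" for s
    using multiplier_simps(11)[of "extend_hom \<delta> x" "\<delta> a" s] by simp
  show ?thesis
    by (rule tensor_eqI(1)[OF nd2]) (simp add: T1_times * flip: mleft_mult[OF nd2])
qed

lemma extend_counit_mult: "\<epsilon> (mleft x a) = extend_hom \<epsilon> x * \<epsilon> a"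
proof -
  have "\<epsilon> (mleft x a) = extend_hom \<epsilon> (x * embed a)" using extend_counit by (simp add: mult_embed[OF nd])
  then show ?thesis using extend_counit by (simp add: alg_hom_def)
qed

lemma extend_coinverse_mult: "coinverse \<delta> (mleft x a) = coinverse \<delta> a * extend_antihom (coinverse \<delta>) x"
proof -
  have "coinverse \<delta> (mleft x a) = extend_antihom (coinverse \<delta>) (x * embed a)"
    using extend_coinverse by (simp add: mult_embed[OF nd])
  then show ?thesis using extend_coinverse by (simp add: alg_antihom_def)
qed

text \<open>The law (\<epsilon> \<otimes> \<epsilon>)(\<delta>(x)) = \<epsilon>(x); it will make
  \<epsilon> \<circ> \<Phi> a convolution idempotent.\<close>

lemma extend_counit_comult:
  assumes t: "multiplier_tensor t = extend_hom \<delta> x"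
  shows "mult_map (tensor_map (extend_hom \<epsilon>) (extend_hom \<epsilon>) t) = extend_hom \<epsilon> x"
proof -
  let ?E = "extend_hom \<epsilon>"
  have lin: "clinear ?E" using extend_counit by (simp add: alg_hom_def)
  have *: "\<epsilon> (slice_left \<epsilon> (mleft (multiplier_tensor t) w)) = mult_map (tensor_map ?E ?E t) * \<epsilon> (slice_left \<epsilon> w)" for t w
  proof (induction t rule: tensor_induct)
    case (pure m n)
    show ?case
      by (induction w rule: tensor_induct)
        (simp_all add: linear_simps counit_linear lin clinearD[OF counit_linear] multiplier_tensor_simps
          extend_counit_mult scaleC_complex_def)
  qed (simp_all add: linear_simps lin counit_linear clinearD[OF counit_linear] clinearD[OF clinear_multiplier_tensor])
  obtain e where e: "\<epsilon> e = 1" using counit_nonzero by blast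
  show ?thesis
    \<comment> \<open>With \<epsilon>(e) = 1, applying \<epsilon> \<otimes> \<epsilon> to T1(e
      \<otimes> e) gives \<epsilon>(ee) = 1, and to \<delta>(x)T1(e \<otimes> e) = T1(xe \<otimes>
      e) it gives \<epsilon>(x).\<close>
    using *[of t "T1 \<delta> (e \<otimes>\<^sub>t e)"]
    by (simp add: t extend_comult_T1 counit_T1 counit_mult extend_counit_mult e)
qed

text \<open>The antipode law \<mu>((\<kappa> \<otimes> id)(\<delta>(x))) = \<epsilon>(x)1 for the
  extended maps. It is tested between \<kappa>(p) and q by computing s(\<delta>(x)(p \<otimes> q))
  twice: through \<kappa>(mp) = \<kappa>(p)\<kappa>(m) for the legs m of t, and through s \<circ> T1
  = \<epsilon> \<otimes> id.\<close>

lemma extend_coinverse_comult: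
  assumes t: "multiplier_tensor t = extend_hom \<delta> x"
  shows "mult_map (tensor_map (extend_antihom (coinverse \<delta>)) (\<lambda>z. z) t) = extend_hom \<epsilon> x *\<^sub>C 1"
    (is "?y = _")
proof (rule multiplier_determined_right[OF nd coinverse_nondegenerate])
  fix p
  let ?E = "extend_hom \<epsilon>" and ?K = "extend_antihom (coinverse \<delta>)"
  have lin: "clinear ?K" using extend_coinverse by (simp add: alg_antihom_def)
  define s where "s w = slice_left \<epsilon> (T1i w)" for w
  have s_linear: "s (x + y) = s x + s y" "s 0 = 0" for x y
    by (simp_all add: s_def linear_simps T_linear counit_linear)
  have s_pure: "s (p \<otimes>\<^sub>t q) = mleft (coinverse \<delta> p) q" for p q
    using coinverse_characterization by (simp add: s_def)
  have "s (mleft (multiplier_tensor t) (p \<otimes>\<^sub>t q)) = mleft (coinverse \<delta> p) (mleft (mult_map (tensor_map ?K (\<lambda>z. z) t)) q)" for t q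
    by (induction t rule: tensor_induct)
      (simp_all add: linear_simps lin s_linear clinearD[OF clinear_multiplier_tensor]
        multiplier_tensor_simps s_pure extend_coinverse_mult)
  moreover have "s (mleft (extend_hom \<delta> x) (T1 \<delta> u)) = ?E x *\<^sub>C s (T1 \<delta> u)" for u
    by (induction u rule: tensor_induct)
      (simp_all add: linear_simps T_linear extend_comult_T1 s_linear,
       simp add: s_def counit_linear extend_counit_mult scaleC_scaleC)
  from this[of "T1i (p \<otimes>\<^sub>t _)"]
  have "s (mleft (multiplier_tensor t) (p \<otimes>\<^sub>t q)) = ?E x *\<^sub>C mleft (coinverse \<delta> p) q" for q
    by (simp add: t s_pure)
  ultimately show "coinverse \<delta> p * ?y = coinverse \<delta> p * (?E x *\<^sub>C 1)"
    by (intro multiplier_eqI_left[OF nd]) simp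
qed

end


section \<open>Convolution\<close>

definition convolution :: "('b::complex_vector \<Rightarrow> ('b, 'b) tensor) \<Rightarrow> ('b \<Rightarrow> 'c::complex_algebra) \<Rightarrow> ('b \<Rightarrow> 'c) \<Rightarrow> 'b \<Rightarrow> 'c" where
  "convolution \<delta> f g b = mult_map (tensor_map f g (\<delta> b))"

lemma clinear_convolution:
  assumes "clinear \<delta>" and "clinear f" and "clinear g"
  shows "clinear (convolution \<delta> f g)"
  using clinear_compose[OF clinear_mult_map clinear_compose[OF clinear_tensor_map[OF assms(2,3)] assms(1)]]
  by (simp add: convolution_def[abs_def])

lemma convolution_assoc:
  assumes \<delta>: "clinear \<delta>" and coassoc: "\<And>b. tensor_assoc (tensor_map \<delta> id (\<delta> b)) = tensor_map id \<delta> (\<delta> b)"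
    and f: "clinear f" and g: "clinear g" and h: "clinear h"
  shows "convolution \<delta> (convolution \<delta> f g) h = convolution \<delta> f (convolution \<delta> g h)"
proof
  fix b
  let ?H = "\<lambda>t. mult_map (tensor_map g h t)"
  have H: "clinear ?H" by (rule clinear_mult_map_tensor_map[OF g h])
  have c: "clinear (convolution \<delta> f g)" "clinear (convolution \<delta> g h)"
    by (intro clinear_convolution \<delta> f g h)+
  have 1: "mult_map (tensor_map f ?H (tensor_assoc (s \<otimes>\<^sub>t b'))) = mult_map (tensor_map f g s) * h b'" for s b'
    by (induction s rule: tensor_induct)
      (simp_all add: linear_simps f g h H pure_tensor_add_left mult.assoc)
  have "mult_map (tensor_map (convolution \<delta> f g) h t) = mult_map (tensor_map f ?H (tensor_assoc (tensor_map \<delta> id t)))" for t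
    by (induction t rule: tensor_induct) (simp_all add: linear_simps c h f H \<delta> 1, simp add: convolution_def)
  moreover have "mult_map (tensor_map f (convolution \<delta> g h) t) = mult_map (tensor_map f ?H (tensor_map id \<delta> t))" for t
    by (induction t rule: tensor_induct) (simp_all add: linear_simps c h f H \<delta>, simp add: convolution_def)
  ultimately show "convolution \<delta> (convolution \<delta> f g) h b = convolution \<delta> f (convolution \<delta> g h) b"
    by (simp add: convolution_def[of \<delta> _ h] convolution_def[of \<delta> f "convolution \<delta> g h"] coassoc)
qed

text \<open>The map b \<mapsto> \<epsilon>(b)1 is the unit for convolution.\<close>

lemma convolution_counit:
  fixes f :: "'b::complex_vector \<Rightarrow> 'c::complex_unital_algebra"
  assumes f: "clinear f" and \<epsilon>: "clinear \<epsilon>"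
  shows "(\<And>b. slice_left \<epsilon> (\<delta> b) = b) \<Longrightarrow> convolution \<delta> (\<lambda>b. \<epsilon> b *\<^sub>C 1) f = f"
    and "(\<And>b. slice_right \<epsilon> (\<delta> b) = b) \<Longrightarrow> convolution \<delta> f (\<lambda>b. \<epsilon> b *\<^sub>C 1) = f"
proof -
  have 1: "clinear (\<lambda>b. \<epsilon> b *\<^sub>C (1::'c))"
    by (rule clinearI) (simp_all add: clinearD[OF \<epsilon>] scaleC_add_left scaleC_scaleC scaleC_complex_def)
  have "mult_map (tensor_map (\<lambda>b. \<epsilon> b *\<^sub>C 1) f t) = f (slice_left \<epsilon> t)" for t
    by (induction t rule: tensor_induct) (simp_all add: linear_simps f 1 \<epsilon> clinearD[OF f] scaleC_mult_left)
  then show "(\<And>b. slice_left \<epsilon> (\<delta> b) = b) \<Longrightarrow> convolution \<delta> (\<lambda>b. \<epsilon> b *\<^sub>C 1) f = f"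
    by (simp add: convolution_def[abs_def])
  have "mult_map (tensor_map f (\<lambda>b. \<epsilon> b *\<^sub>C 1) t) = f (slice_right \<epsilon> t)" for t
    by (induction t rule: tensor_induct) (simp_all add: linear_simps f 1 \<epsilon> clinearD[OF f] scaleC_mult_right)
  then show "(\<And>b. slice_right \<epsilon> (\<delta> b) = b) \<Longrightarrow> convolution \<delta> f (\<lambda>b. \<epsilon> b *\<^sub>C 1) = f"
    by (simp add: convolution_def[abs_def])
qed

text \<open>A unital homomorphism carries the antipode identity of the Hopf algebra to its target,
  so f \<circ> \<kappa> is a right convolution inverse of f.\<close>

lemma convolution_antipode:
  fixes f :: "'b::complex_unital_algebra \<Rightarrow> 'c::complex_unital_algebra"
  assumes "hopf_algebra \<delta> \<epsilon> \<kappa>" and "alg_hom f" and "f 1 = 1"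
  shows "convolution \<delta> f (\<lambda>b. f (\<kappa> b)) = (\<lambda>b. \<epsilon> b *\<^sub>C 1)"
proof
  fix b
  have f: "clinear f" and \<kappa>: "clinear \<kappa>" using assms by (auto simp: alg_hom_def hopf_algebra_def)
  have "mult_map (tensor_map f (\<lambda>b. f (\<kappa> b)) t) = f (mult_map (tensor_map id \<kappa> t))" for t
    by (induction t rule: tensor_induct)
      (use assms(2) in \<open>simp_all add: linear_simps f \<kappa> clinear_compose[OF f \<kappa>] clinearD[OF f] alg_hom_def\<close>)
  then show "convolution \<delta> f (\<lambda>b. f (\<kappa> b)) b = \<epsilon> b *\<^sub>C 1"
    using assms by (simp add: convolution_def hopf_algebra_def clinearD[OF f])
qed

text \<open>Supplies the nonzero element that the counit construction starts from: there is at least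
  one summand, of positive size.\<close>

lemma matrix_direct_sum_nontrivial:
  assumes "direct_sum_of_matrix_algebras TYPE('a::complex_algebra)"
  shows "\<exists>a::'a. a \<noteq> 0"
proof (rule ccontr)
  assume trivial: "\<nexists>a::'a. a \<noteq> 0"
  obtain I :: "'a set" and n and \<phi> :: "'a \<Rightarrow> 'a \<Rightarrow> complex mat" where I: "I \<noteq> {}" "\<forall>i\<in>I. 0 < n i"
    and bij: "bij_betw \<phi> UNIV (matrix_direct_sum I n)"
    and scale: "\<forall>c a. \<forall>i\<in>I. \<phi> (c *\<^sub>C a) i = c \<cdot>\<^sub>m \<phi> a i"
    using assms unfolding direct_sum_of_matrix_algebras_def by blast
  obtain i where i: "i \<in> I" using I by blast
  \<comment> \<open>The unit of the summand at \<open>i\<close>. In a zero algebra its preimage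
    would equal 0 times itself, forcing the identity matrix to be zero.\<close>
  define f where "f = (\<lambda>j\<in>I. if j = i then 1\<^sub>m (n i) else 0\<^sub>m (n j) (n j) :: complex mat)"
  have "{j \<in> I. f j \<noteq> 0\<^sub>m (n j) (n j)} \<subseteq> {i}" by (auto simp: f_def)
  then have "f \<in> matrix_direct_sum I n"
    unfolding matrix_direct_sum_def by (auto simp: f_def intro: finite_subset split: if_splits)
  then have "f \<in> range \<phi>" using bij_betw_imp_surj_on[OF bij] by simp
  then obtain a where a: "\<phi> a = f" by blast
  have "\<phi> a i = 0 \<cdot>\<^sub>m \<phi> a i" using scale[rule_format, OF i, of 0 a] trivial by metis
  then have "1\<^sub>m (n i) = 0 \<cdot>\<^sub>m (1\<^sub>m (n i) :: complex mat)" using i by (simp add: a f_def)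
  then have "(1\<^sub>m (n i) :: complex mat) $$ (0, 0) = (0 \<cdot>\<^sub>m 1\<^sub>m (n i)) $$ (0, 0)" by simp
  then show False using I(2) i by simp
qed

section \<open>Compatibility with the Hopf structure of \<open>AP\<close>, and uniqueness\<close>

theorem theorem4p5:
  fixes \<delta> :: "'a::complex_star_algebra \<Rightarrow> ('a, 'a) tensor multiplier"
    and \<delta>\<^sub>B :: "'b::complex_unital_algebra \<Rightarrow> ('b, 'b) tensor"
    and \<epsilon>\<^sub>B :: "'b \<Rightarrow> complex"
    and \<kappa>\<^sub>B :: "'b \<Rightarrow> 'b"
    and \<Phi> :: "'b \<Rightarrow> 'a multiplier"
  assumes "discrete_quantum_group \<delta>"
    and "hopf_algebra \<delta>\<^sub>B \<epsilon>\<^sub>B \<kappa>\<^sub>B"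
    and "nondegenerate_hom \<Phi>"
    and "multiplier_tensor \<circ> tensor_map \<Phi> \<Phi> \<circ> \<delta>\<^sub>B = extend_hom \<delta> \<circ> \<Phi>"
  shows "\<exists>!\<Phi>'. hopf_hom_into \<delta>\<^sub>B \<epsilon>\<^sub>B \<kappa>\<^sub>B (AP \<delta>) (AP_comult \<delta>) (AP_counit \<delta>) (AP_coinverse \<delta>) \<Phi>'
           \<and> \<Phi> = inclusion (AP \<delta>) \<circ> \<Phi>'"
proof -
  interpret multiplier_hopf \<delta>
    using assms(1) matrix_direct_sum_nontrivial
    by unfold_locales (auto simp: discrete_quantum_group_def multiplier_hopf_star_algebra_def)
  have \<Phi>: "alg_hom \<Phi>" and \<Phi>_nd: "nondegenerate_map \<Phi>" using assms(3) by (auto simp: nondegenerate_hom_iff)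
  then have \<Phi>_lin: "clinear \<Phi>" and \<Phi>_mult: "\<Phi> (a * b) = \<Phi> a * \<Phi> b" for a b by (auto simp: alg_hom_def)
  \<comment> \<open>Both sides agree after multiplication by \<Phi>(b), which suffices by non
    degeneracy.\<close>
  have \<Phi>_one: "\<Phi> 1 = 1" by (rule multiplier_determined[OF nd \<Phi>_nd]) (simp flip: \<Phi>_mult)
  have comult: "multiplier_tensor (tensor_map \<Phi> \<Phi> (\<delta>\<^sub>B b)) = extend_hom \<delta> (\<Phi> b)" for b
    using fun_cong[OF assms(4), of b] by simp
  have AP: "\<Phi> b \<in> AP \<delta>" for b unfolding AP_def using comult[of b, symmetric] by simp
  have \<delta>B: "clinear \<delta>\<^sub>B" and \<epsilon>B: "clinear \<epsilon>\<^sub>B" and \<kappa>B: "clinear \<kappa>\<^sub>B"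
    and coassoc: "\<And>b. tensor_assoc (tensor_map \<delta>\<^sub>B id (\<delta>\<^sub>B b)) = tensor_map id \<delta>\<^sub>B (\<delta>\<^sub>B b)"
    and counitB: "\<And>b. slice_left \<epsilon>\<^sub>B (\<delta>\<^sub>B b) = b" "\<And>b. slice_right \<epsilon>\<^sub>B (\<delta>\<^sub>B b) = b"
    using assms(2) by (auto simp: hopf_algebra_def alg_hom_def)
  note conv_assoc = convolution_assoc[OF \<delta>B coassoc]

  \<comment> \<open>The tensor (\<Phi> \<otimes> \<Phi>)(\<open>\<delta>\<^sub>B\<close> b) has its
    legs in \<open>AP\<close> and represents \<delta>(\<Phi>(b)); injectivity of M(A) \<otimes> M(A)
    \<rightarrow> M(A \<otimes> A) makes it the only candidate.\<close>
  have "AP_comult \<delta> (\<Phi> b) = tensor_map \<Phi> \<Phi> (\<delta>\<^sub>B b)" for b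
    unfolding AP_comult_def
  proof (rule the_equality)
    have "tensor_map \<Phi> \<Phi> t \<in> tensor_subspace (AP \<delta>) (AP \<delta>)" for t
      unfolding tensor_subspace_def
      by (induction t rule: tensor_induct)
        (use AP in \<open>auto simp: linear_simps \<Phi>_lin complex_vector.span_zero
          intro: complex_vector.span_add complex_vector.span_base\<close>)
    with comult show "tensor_map \<Phi> \<Phi> (\<delta>\<^sub>B b) \<in> tensor_subspace (AP \<delta>) (AP \<delta>) \<and>
      multiplier_tensor (tensor_map \<Phi> \<Phi> (\<delta>\<^sub>B b)) = extend_hom \<delta> (\<Phi> b)" by blast
  next
    fix t assume "t \<in> tensor_subspace (AP \<delta>) (AP \<delta>) \<and> multiplier_tensor t = extend_hom \<delta> (\<Phi> b)"
    then show "t = tensor_map \<Phi> \<Phi> (\<delta>\<^sub>B b)"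
      by (intro inj_multiplier_tensor[OF nd nd]) (simp add: comult)
  qed

  moreover have "AP_counit \<delta> (\<Phi> b) = \<epsilon>\<^sub>B b" for b
  proof -
    define \<eta> where "\<eta> b = extend_hom \<epsilon> (\<Phi> b)" for b
    have E: "clinear (extend_hom \<epsilon>)" using extend_counit by (simp add: alg_hom_def)
    have \<eta>: "alg_hom \<eta>" "\<eta> 1 = 1" "clinear \<eta>"
      unfolding \<eta>_def using extend_counit clinear_compose[OF E \<Phi>_lin]
      by (simp_all add: alg_hom_def \<Phi>_mult \<Phi>_one)
    define \<theta> where "\<theta> b = \<eta> (\<kappa>\<^sub>B b)" for b
    have \<theta>: "clinear \<theta>" unfolding \<theta>_def by (rule clinear_compose[OF \<eta>(3) \<kappa>B])
    have idem: "convolution \<delta>\<^sub>B \<eta> \<eta> = \<eta>"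
      using extend_counit_comult[OF comult]
      by (simp add: convolution_def[abs_def] tensor_map_compose E \<Phi>_lin flip: \<eta>_def[abs_def])
    have inverse: "convolution \<delta>\<^sub>B \<eta> \<theta> = (\<lambda>b. \<epsilon>\<^sub>B b *\<^sub>C 1)"
      using convolution_antipode[OF assms(2) \<eta>(1,2)] by (simp add: \<theta>_def[abs_def])
    have "\<eta> = convolution \<delta>\<^sub>B \<eta> (convolution \<delta>\<^sub>B \<eta> \<theta>)"
      unfolding inverse by (rule convolution_counit(2)[OF \<eta>(3) \<epsilon>B counitB(2), symmetric])
    also have "\<dots> = convolution \<delta>\<^sub>B \<eta> \<theta>" unfolding conv_assoc[OF \<eta>(3) \<eta>(3) \<theta>, symmetric] idem ..
    finally have "\<eta> b = \<epsilon>\<^sub>B b *\<^sub>C 1" by (simp only: inverse)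
    then show ?thesis by (simp add: AP_counit_def AP \<eta>_def scaleC_complex_def)
  qed

  moreover have "AP_coinverse \<delta> (\<Phi> b) = \<Phi> (\<kappa>\<^sub>B b)" for b
  proof -
    define \<sigma> where "\<sigma> b = extend_antihom (coinverse \<delta>) (\<Phi> b)" for b
    define \<tau> where "\<tau> b = \<Phi> (\<kappa>\<^sub>B b)" for b
    have K: "clinear (extend_antihom (coinverse \<delta>))" using extend_coinverse by (simp add: alg_antihom_def)
    have \<sigma>: "clinear \<sigma>" unfolding \<sigma>_def by (rule clinear_compose[OF K \<Phi>_lin])
    have \<tau>: "clinear \<tau>" unfolding \<tau>_def by (rule clinear_compose[OF \<Phi>_lin \<kappa>B])
    \<comment> \<open>The counit identity just shown turns the antipode law in M(A) into a
      convolution identity over \<open>\<epsilon>\<^sub>B\<close>.\<close>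
    have counit: "extend_hom \<epsilon> (\<Phi> b) = \<epsilon>\<^sub>B b" for b
      using \<open>\<And>b. AP_counit \<delta> (\<Phi> b) = \<epsilon>\<^sub>B b\<close>[of b] by (simp add: AP_counit_def AP)
    have left: "convolution \<delta>\<^sub>B \<sigma> \<Phi> = (\<lambda>b. \<epsilon>\<^sub>B b *\<^sub>C 1)"
      using extend_coinverse_comult[OF comult]
      by (simp add: convolution_def[abs_def] tensor_map_compose K \<Phi>_lin clinear_id counit flip: \<sigma>_def[abs_def])
    have right: "convolution \<delta>\<^sub>B \<Phi> \<tau> = (\<lambda>b. \<epsilon>\<^sub>B b *\<^sub>C 1)"
      using convolution_antipode[OF assms(2) \<Phi> \<Phi>_one] by (simp add: \<tau>_def[abs_def])
    have "\<sigma> = convolution \<delta>\<^sub>B \<sigma> (convolution \<delta>\<^sub>B \<Phi> \<tau>)"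
      unfolding right by (rule convolution_counit(2)[OF \<sigma> \<epsilon>B counitB(2), symmetric])
    also have "\<dots> = convolution \<delta>\<^sub>B (convolution \<delta>\<^sub>B \<sigma> \<Phi>) \<tau>"
      by (rule conv_assoc[OF \<sigma> \<Phi>_lin \<tau>, symmetric])
    also have "\<dots> = \<tau>" unfolding left by (rule convolution_counit(1)[OF \<tau> \<epsilon>B counitB(1)])
    finally have "\<sigma> b = \<tau> b" by simp
    then show ?thesis by (simp add: AP_coinverse_def AP \<sigma>_def \<tau>_def)
  qed

  ultimately have "hopf_hom_into \<delta>\<^sub>B \<epsilon>\<^sub>B \<kappa>\<^sub>B (AP \<delta>) (AP_comult \<delta>) (AP_counit \<delta>) (AP_coinverse \<delta>) \<Phi>"
    using AP \<Phi> \<Phi>_one unfolding hopf_hom_into_def by blast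
  moreover have "\<Phi> = inclusion (AP \<delta>) \<circ> \<Phi>" using AP by (auto simp: inclusion_def)
  \<comment> \<open>The inclusion is the identity on \<open>AP\<close>, so the factorization alone
    fixes the map.\<close>
  moreover have "\<Phi>' = \<Phi>" if "range \<Phi>' \<subseteq> AP \<delta>" "\<Phi> = inclusion (AP \<delta>) \<circ> \<Phi>'" for \<Phi>'
    unfolding that(2) using that(1) by (auto simp: inclusion_def fun_eq_iff image_subset_iff)
  ultimately show ?thesis by (metis hopf_hom_into_def)
qed

end
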